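(* Let $(M^{2n},J,\omega)$ be a compact Hermitian manifold of complex dimension $n$, let $t\in\mathbb R$, let $f\colon M\to\mathbb R$ be a smooth function, and let $c\in\mathbb R$ be a constant. Then the conformal metric $e^f\omega$ has constant $t$-deformed scalar curvature equal to $c$, namely $\mu^t(e^f\omega)=c$, if and only if the function $u:=e^{\frac{n-1}{2}f}$ is a smooth positive solution of the semilinear equation $$\frac{2t}{n-1}\Delta u+\mu^t(\omega)\,u=c\,u^{\frac{n+1}{n-1}} .$$
   Context: $n\geq2$. A Hermitian metric $g$ on $(M^{2n},J)$ is identified with its $(1,1)$-form $\omega=g(J\cdot,\cdot)$. $d^*$ is the codifferential of $g$, $\Delta=d^*d+dd^*$ is the (non-negative) Hodge--de Rham Laplacian of $\omega$, and $D^g$ is the Levi-Civita connection. Chern connection: $g(D^{\mathrm{Ch}}_XY,Z)=g(D^g_XY,Z)-\tfrac12 d\omega(JX,Y,Z)$. Its torsion $T$ is given by $-2g(T(X,Y),Z)=d\omega(JX,Y,Z)+d\omega(X,JY,Z)$, and $|T|^2=\sum_{\alpha,\beta}|T(e_\alpha,e_\beta)|^2$ for a local $g$-orthonormal frame $\{e_\alpha\}_{\alpha=1}^{2n}$. The Lee form is $\theta=\sum_\alpha g(T(\cdot,e_\alpha),e_\alpha)$; equivalently $d\omega^{n-1}=\theta\wedge\omega^{n-1}$. The Chern curvature is $\Theta(X,Y,Z,W)=g(D^{\mathrm{Ch}}_XD^{\mathrm{Ch}}_YZ-D^{\mathrm{Ch}}_YD^{\mathrm{Ch}}_XZ-D^{\mathrm{Ch}}_{[X,Y]}Z,W)$,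 and the Chern scalar curvature is $\mathrm{scal}^{\mathrm{Ch}}(\omega)=-2\sum_{i,j=1}^n\Theta(e_i,Je_i,e_j,Je_j)$ for a local unitary frame $\{e_i,Je_i\}_{i=1}^n$. For $t\in\mathbb R$ the $t$-deformed scalar curvature is $\mu^t(\omega)=\mathrm{scal}^{\mathrm{Ch}}(\omega)+\frac{t-n}{n-1}\,d^*\theta+\frac{t-2n}{4}\,|T|^2$. *)

theory Defs
  imports "HOL-Analysis.Analysis"
begin

section \<open>Smooth functions between normed spaces\<close>

primrec Ck_on :: "nat \<Rightarrow> 'a::real_normed_vector set \<Rightarrow> ('a \<Rightarrow> 'b::real_normed_vector) \<Rightarrow> bool" where
  "Ck_on 0 S f = continuous_on S f"
| "Ck_on (Suc k) S f =
     ((\<forall>x\<in>S. f differentiable (at x)) \<and> (\<forall>v. Ck_on k S (\<lambda>x. frechet_derivative f (at x) v)))"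

text \<open>Only meant for open \<open>S\<close>, since full derivatives \<open>at x\<close> are used.\<close>
definition smooth_on :: "'a::real_normed_vector set \<Rightarrow> ('a \<Rightarrow> 'b::real_normed_vector) \<Rightarrow> bool" where
  "smooth_on S f \<longleftrightarrow> (\<forall>k. Ck_on k S f)"


section \<open>Complex manifolds and Hermitian metrics\<close>

text \<open>The complex structure of \<open>\<complex>\<^sup>n\<close>, viewed as a real Euclidean space of dimension \<open>2n\<close>.\<close>
definition J :: "complex^'n \<Rightarrow> complex^'n" where
  "J v = \<i> *s v"

text \<open>A map between open subsets of \<open>\<complex>\<^sup>n\<close> is holomorphic if it is differentiable over the reals
  with complex linear derivative.\<close>
definition holo_on :: "(complex^'n::finite) set \<Rightarrow> (complex^'n \<Rightarrow> complex^'n) \<Rightarrow> bool" where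
  "holo_on S F \<longleftrightarrow> (\<forall>x\<in>S. \<exists>D. (F has_derivative D) (at x) \<and> (\<forall>v. D (J v) = J (D v)))"

text \<open>A chart \<open>(U, \<phi>)\<close> consists of its domain and its coordinate map; only the values of \<open>\<phi>\<close> on
  \<open>U\<close> matter.\<close>
type_synonym ('a, 'n) chart = "'a set \<times> ('a \<Rightarrow> complex^'n)"

definition chart_image :: "('a, 'n::finite) chart \<Rightarrow> (complex^'n) set" where
  "chart_image K = snd K ` fst K"

definition chart_inv :: "('a, 'n::finite) chart \<Rightarrow> complex^'n \<Rightarrow> 'a" where
  "chart_inv K = inv_into (fst K) (snd K)"

definition transition :: "('a, 'n::finite) chart \<Rightarrow> ('a, 'n) chart \<Rightarrow> complex^'n \<Rightarrow> complex^'n" where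
  "transition K L = snd L \<circ> chart_inv K"

text \<open>\<open>M\<close> is the underlying space and \<open>A\<close> a (not necessarily maximal) holomorphic atlas.  The almost
  complex structure of the manifold is the one that is given by \<^const>\<open>J\<close> in every chart of \<open>A\<close>.\<close>
definition complex_manifold :: "'a topology \<Rightarrow> ('a, 'n::finite) chart set \<Rightarrow> bool" where
  "complex_manifold M A \<longleftrightarrow>
     Hausdorff_space M \<and> second_countable M \<and> (\<Union>K\<in>A. fst K) = topspace M \<and>
     (\<forall>K\<in>A. openin M (fst K) \<and> open (chart_image K) \<and>
        homeomorphic_map (subtopology M (fst K)) (top_of_set (chart_image K)) (snd K)) \<and>
     (\<forall>K\<in>A. \<forall>L\<in>A. holo_on (snd K ` (fst K \<inter> fst L)) (transition K L))"

definition smooth_function :: "('a, 'n::finite) chart set \<Rightarrow> ('a \<Rightarrow> real) \<Rightarrow> bool" where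
  "smooth_function A f \<longleftrightarrow> (\<forall>K\<in>A. smooth_on (chart_image K) (f \<circ> chart_inv K))"

text \<open>A covariant 2-tensor field on an open subset of \<open>\<complex>\<^sup>n\<close>: \<open>g x u v\<close> is its value on the tangent
  vectors \<open>u\<close>, \<open>v\<close> at the point \<open>x\<close>.\<close>
type_synonym 'n tensor2 = "complex^'n \<Rightarrow> complex^'n \<Rightarrow> complex^'n \<Rightarrow> real"

text \<open>A Hermitian metric is given by its coordinate expressions \<open>g K\<close> in the charts \<open>K\<close> of the atlas,
  which are related by pull-back along the coordinate changes.\<close>
definition hermitian_metric ::
    "('a, 'n::finite) chart set \<Rightarrow> (('a, 'n) chart \<Rightarrow> 'n tensor2) \<Rightarrow> bool" where
  "hermitian_metric A g \<longleftrightarrow>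
     (\<forall>K\<in>A. (\<forall>u v. smooth_on (chart_image K) (\<lambda>x. g K x u v)) \<and>
        (\<forall>x\<in>chart_image K. bilinear (g K x) \<and> (\<forall>u v. g K x u v = g K x v u) \<and>
           (\<forall>u. u \<noteq> 0 \<longrightarrow> g K x u u > 0) \<and> (\<forall>u v. g K x (J u) (J v) = g K x u v))) \<and>
     (\<forall>K\<in>A. \<forall>L\<in>A. \<forall>x\<in>snd K ` (fst K \<inter> fst L). \<forall>u v.
        g K x u v = g L (transition K L x) (frechet_derivative (transition K L) (at x) u)
                                           (frechet_derivative (transition K L) (at x) v))"

text \<open>The metric with fundamental form \<open>e\<^sup>f \<omega>\<close>.\<close>
definition conformal ::
    "('a \<Rightarrow> real) \<Rightarrow> (('a, 'n::finite) chart \<Rightarrow> 'n tensor2) \<Rightarrow> ('a, 'n) chart \<Rightarrow> 'n tensor2" where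
  "conformal f g K x u v = exp (f (chart_inv K x)) * g K x u v"


section \<open>Hermitian geometry in a holomorphic chart\<close>

text \<open>Throughout, \<open>g\<close> is the coordinate expression of a Hermitian metric on an open subset of \<open>\<complex>\<^sup>n\<close>.
  Vector fields are functions from \<open>\<complex>\<^sup>n\<close> to itself; a tangent vector is extended to a vector
  field by the field that is constant in the coordinates.  All operations at \<open>x\<close> depend only on
  the values of the fields near \<open>x\<close>.\<close>

type_synonym 'n vfield = "complex^'n \<Rightarrow> complex^'n"

definition fund_form :: "'n::finite tensor2 \<Rightarrow> 'n tensor2" where
  "fund_form g x u v = g x (J u) v"

text \<open>The exterior derivative \<open>d\<omega>\<close> of the fundamental form, with the normalisation
  \<open>d\<omega>(X,Y,Z) = X \<omega>(Y,Z) - Y \<omega>(X,Z) + Z \<omega>(X,Y) - \<dots>\<close>; the bracket terms vanish for constant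
  fields.\<close>
definition d_fund ::
    "'n::finite tensor2 \<Rightarrow> complex^'n \<Rightarrow> complex^'n \<Rightarrow> complex^'n \<Rightarrow> complex^'n \<Rightarrow> real" where
  "d_fund g x u v w =
     frechet_derivative (\<lambda>y. fund_form g y v w) (at x) u
   - frechet_derivative (\<lambda>y. fund_form g y u w) (at x) v
   + frechet_derivative (\<lambda>y. fund_form g y u v) (at x) w"

definition sharp :: "'n::finite tensor2 \<Rightarrow> complex^'n \<Rightarrow> (complex^'n \<Rightarrow> real) \<Rightarrow> complex^'n" where
  "sharp g x l = (THE w. \<forall>z. g x w z = l z)"

text \<open>The Christoffel tensor \<open>\<Gamma>(u,v) = D\<^sup>g\<^sub>u v\<close> (for constant fields) of the Levi-Civita connection: it
  is the unique one for which the connection is torsion-free and preserves the metric.\<close>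
definition christoffel ::
    "'n::finite tensor2 \<Rightarrow> complex^'n \<Rightarrow> complex^'n \<Rightarrow> complex^'n \<Rightarrow> complex^'n" where
  "christoffel g x = (THE \<Gamma>. bilinear \<Gamma> \<and> (\<forall>u v. \<Gamma> u v = \<Gamma> v u) \<and>
     (\<forall>u v w. frechet_derivative (\<lambda>y. g y v w) (at x) u = g x (\<Gamma> u v) w + g x v (\<Gamma> u w)))"

definition levi_civita :: "'n::finite tensor2 \<Rightarrow> 'n vfield \<Rightarrow> 'n vfield \<Rightarrow> 'n vfield" where
  "levi_civita g X Y x = frechet_derivative Y (at x) (X x) + christoffel g x (X x) (Y x)"

definition chern_connection :: "'n::finite tensor2 \<Rightarrow> 'n vfield \<Rightarrow> 'n vfield \<Rightarrow> 'n vfield" where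
  "chern_connection g X Y x =
     sharp g x (\<lambda>z. g x (levi_civita g X Y x) z - 1/2 * d_fund g x (J (X x)) (Y x) z)"

definition torsion ::
    "'n::finite tensor2 \<Rightarrow> complex^'n \<Rightarrow> complex^'n \<Rightarrow> complex^'n \<Rightarrow> complex^'n" where
  "torsion g x u v =
     sharp g x (\<lambda>z. - 1/2 * (d_fund g x (J u) v z + d_fund g x u (J v) z))"

definition lie_bracket :: "'n::finite vfield \<Rightarrow> 'n vfield \<Rightarrow> 'n vfield" where
  "lie_bracket X Y x = frechet_derivative Y (at x) (X x) - frechet_derivative X (at x) (Y x)"

definition chern_curvature ::
    "'n::finite tensor2 \<Rightarrow> 'n vfield \<Rightarrow> 'n vfield \<Rightarrow> 'n vfield \<Rightarrow> 'n vfield \<Rightarrow> complex^'n \<Rightarrow> real" where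
  "chern_curvature g X Y Z W x =
     g x (chern_connection g X (chern_connection g Y Z) x
        - chern_connection g Y (chern_connection g X Z) x
        - chern_connection g (lie_bracket X Y) Z x) (W x)"

text \<open>An orthonormal basis \<open>e 0, \<dots>, e (2n - 1)\<close> of the tangent space at \<open>x\<close>.\<close>
definition orthonormal_frame :: "'n::finite tensor2 \<Rightarrow> complex^'n \<Rightarrow> (nat \<Rightarrow> complex^'n) \<Rightarrow> bool" where
  "orthonormal_frame g x e \<longleftrightarrow>
     (\<forall>\<alpha><2 * CARD('n). \<forall>\<beta><2 * CARD('n). g x (e \<alpha>) (e \<beta>) = (if \<alpha> = \<beta> then 1 else 0))"

text \<open>The vectors \<open>e i\<close>, \<open>J (e i)\<close> form an orthonormal basis of the tangent space at \<open>x\<close>.\<close>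
definition unitary_frame :: "'n::finite tensor2 \<Rightarrow> complex^'n \<Rightarrow> ('n \<Rightarrow> complex^'n) \<Rightarrow> bool" where
  "unitary_frame g x e \<longleftrightarrow>
     (\<forall>i j. g x (e i) (e j) = (if i = j then 1 else 0) \<and>
            g x (J (e i)) (J (e j)) = (if i = j then 1 else 0) \<and> g x (e i) (J (e j)) = 0)"

text \<open>The traces below do not depend on the frame, so they are computed in a chosen one.  As the
  traced quantities are tensorial, frames are only needed pointwise.\<close>
definition some_orthonormal_frame :: "'n::finite tensor2 \<Rightarrow> complex^'n \<Rightarrow> nat \<Rightarrow> complex^'n" where
  "some_orthonormal_frame g x = (SOME e. orthonormal_frame g x e)"

definition some_unitary_frame :: "'n::finite tensor2 \<Rightarrow> complex^'n \<Rightarrow> 'n \<Rightarrow> complex^'n" where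
  "some_unitary_frame g x = (SOME e. unitary_frame g x e)"

definition torsion_norm_sq :: "'n::finite tensor2 \<Rightarrow> complex^'n \<Rightarrow> real" where
  "torsion_norm_sq g x =
     (let e = some_orthonormal_frame g x in
      \<Sum>\<alpha><2 * CARD('n). \<Sum>\<beta><2 * CARD('n).
        g x (torsion g x (e \<alpha>) (e \<beta>)) (torsion g x (e \<alpha>) (e \<beta>)))"

definition lee_form :: "'n::finite tensor2 \<Rightarrow> complex^'n \<Rightarrow> complex^'n \<Rightarrow> real" where
  "lee_form g x v =
     (let e = some_orthonormal_frame g x in
      \<Sum>\<alpha><2 * CARD('n). g x (torsion g x v (e \<alpha>)) (e \<alpha>))"

definition chern_scal :: "'n::finite tensor2 \<Rightarrow> complex^'n \<Rightarrow> real" where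
  "chern_scal g x =
     (let e = some_unitary_frame g x in
      - 2 * (\<Sum>i\<in>UNIV. \<Sum>j\<in>UNIV.
        chern_curvature g (\<lambda>_. e i) (\<lambda>_. J (e i)) (\<lambda>_. e j) (\<lambda>_. J (e j)) x))"

text \<open>The codifferential \<open>d\<^sup>* \<beta> = - \<Sum>\<^sub>\<alpha> (D\<^sup>g\<^sub>e \<beta>)(e)\<close>, \<open>e = e\<^sub>\<alpha>\<close>, of a 1-form \<open>\<beta>\<close>.\<close>
definition codiff :: "'n::finite tensor2 \<Rightarrow> (complex^'n \<Rightarrow> complex^'n \<Rightarrow> real) \<Rightarrow> complex^'n \<Rightarrow> real" where
  "codiff g \<beta> x =
     (let e = some_orthonormal_frame g x in
      - (\<Sum>\<alpha><2 * CARD('n). frechet_derivative (\<lambda>y. \<beta> y (e \<alpha>)) (at x) (e \<alpha>)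
                              - \<beta> x (christoffel g x (e \<alpha>) (e \<alpha>))))"

text \<open>On functions \<open>d\<^sup>*\<close> vanishes, so that \<open>\<Delta> = d\<^sup>* d\<close>.\<close>
definition hodge_laplacian :: "'n::finite tensor2 \<Rightarrow> (complex^'n \<Rightarrow> real) \<Rightarrow> complex^'n \<Rightarrow> real" where
  "hodge_laplacian g h = codiff g (\<lambda>y v. frechet_derivative h (at y) v)"

definition deformed_scal :: "real \<Rightarrow> 'n::finite tensor2 \<Rightarrow> complex^'n \<Rightarrow> real" where
  "deformed_scal t g x =
     (let n = real CARD('n) in
      chern_scal g x + (t - n) / (n - 1) * codiff g (lee_form g) x
        + (t - 2 * n) / 4 * torsion_norm_sq g x)"


section \<open>The scalar invariants on the manifold\<close>

text \<open>The values at \<open>p\<close> of \<open>\<mu>\<^sup>t(\<omega>)\<close> and \<open>\<Delta>u\<close>, computed in the chart \<open>K\<close> around \<open>p\<close>.  Equations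
  between functions on the manifold are required in every chart of the atlas.\<close>
definition \<mu> ::
    "real \<Rightarrow> (('a, 'n::finite) chart \<Rightarrow> 'n tensor2) \<Rightarrow> ('a, 'n) chart \<Rightarrow> 'a \<Rightarrow> real" where
  "\<mu> t g K p = deformed_scal t (g K) (snd K p)"

definition laplacian ::
    "(('a, 'n::finite) chart \<Rightarrow> 'n tensor2) \<Rightarrow> ('a \<Rightarrow> real) \<Rightarrow> ('a, 'n) chart \<Rightarrow> 'a \<Rightarrow> real" where
  "laplacian g u K p = hodge_laplacian (g K) (u \<circ> chart_inv K) (snd K p)"

end

theory Submission
  imports Defs
begin

text \<open>
  All the scalar quantities are computed pointwise in a holomorphic chart.  There the Chern
  connection of a Hermitian metric \<open>g\<close> is governed by the tensor \<open>C(u,v)\<close>, its value on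
  coordinate-constant fields, for which the terms of the Koszul formula and of \<open>d\<omega>\<close> collapse to
  \<open>g(C(u,v), z) = 1/2 (\<partial>\<^sub>u g(v,z) - \<partial>\<^sub>J\<^sub>u g(Jv,z))\<close>.  From this formula one reads off that \<open>C\<close> is
  complex linear in both arguments, that the torsion is \<open>T(u,v) = C(u,v) - C(v,u)\<close>, and that
  replacing \<open>g\<close> by \<open>e\<^sup>F g\<close> adds \<open>1/2 (dF(u) v - dF(Ju) Jv)\<close> to \<open>C\<close>.  The Levi-Civita connection
  enters only through the codifferential, and there only through the trace of its Christoffel
  tensor, which is minus the metric dual of the Lee form; hence
  \<open>d\<^sup>*\<beta> = - tr(\<partial>\<beta>) - \<langle>\<beta>,\<theta>\<rangle>\<close> for every Hermitian metric.

  Let \<open>H\<close> be the trace of the coordinate Hessian of \<open>F\<close>, \<open>P = \<langle>dF,\<theta>\<rangle>\<close> and \<open>Q = |dF|\<^sup>2\<close>, all taken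
  with respect to \<open>g\<close>, and mark the quantities of \<open>e\<^sup>F g\<close> by a prime.  Then

    \<open>e\<^sup>F scal' = scal - n H\<close>,

    \<open>e\<^sup>F d\<^sup>*'\<theta>' = d\<^sup>*\<theta> - (n - 1) (H + 2 P + (n - 1) Q)\<close>,

    \<open>e\<^sup>F |T'|\<^sup>2 = |T|\<^sup>2 + 4 P + 2 (n - 1) Q\<close>,

  which are the lemmas \<open>conformal_chern_scal\<close>, \<open>conformal_codiff_lee_form\<close> and
  \<open>conformal_torsion_norm_sq\<close>.  In the combination \<open>\<mu>\<^sup>t\<close> the coefficients of \<open>H\<close>, \<open>P\<close> and \<open>Q\<close> add up
  to \<open>-t\<close>, \<open>-t\<close> and \<open>-t (n - 1)/2\<close>.  On the other hand
  \<open>\<Delta> e\<^sup>k\<^sup>F = -k e\<^sup>k\<^sup>F (H + P + k Q)\<close>, so for \<open>k = (n - 1)/2\<close> and \<open>u = e\<^sup>k\<^sup>F\<close> the two computations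
  combine to \<open>u e\<^sup>F \<mu>\<^sup>t(e\<^sup>F g) = 2t/(n - 1) \<Delta>u + \<mu>\<^sup>t(g) u\<close>.  As \<open>u e\<^sup>F\<close> is the power of \<open>u\<close> on the right
  of the equation, the two conditions agree at every point.

  Two points need care.  The frames chosen for \<open>g\<close> and for \<open>e\<^sup>F g\<close> are unrelated, so every trace has
  to be shown independent of the frame.  And the curvature and the codifferential differentiate
  tensors that are obtained by raising an index, so raising an index must be shown to preserve
  differentiability; this is done with Cramer's rule.
\<close>

section \<open>Hermitian inner products on complex coordinate space\<close>

lemma J_add: "J (u + v) = J u + J v"
  by (simp add: J_def vec_eq_iff algebra_simps)

lemma J_scaleR: "J (r *\<^sub>R v) = r *\<^sub>R J v"
  by (simp add: J_def vec_eq_iff algebra_simps)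

lemma linear_J: "linear J"
  by (rule linearI) (rule J_add J_scaleR)+

lemma J_J [simp]: "J (J v) = - v"
  by (simp add: J_def vec_eq_iff)

lemma J_minus: "J (- v) = - J v" and J_diff: "J (u - v) = J u - J v" and J_zero [simp]: "J 0 = 0"
  by (auto simp: J_def vec_eq_iff algebra_simps)

lemma J_sum: "J (\<Sum>i\<in>I. f i) = (\<Sum>i\<in>I. J (f i))"
  by (rule linear_sum [OF linear_J])

lemmas J_linear = J_add J_scaleR J_minus J_diff J_sum

lemma bilinearI:
  assumes "\<And>x y z. B (x + y) z = B x z + B y z" "\<And>r x z. B (r *\<^sub>R x) z = r *\<^sub>R B x z"
    and "\<And>x y z. B z (x + y) = B z x + B z y" "\<And>r x z. B z (r *\<^sub>R x) = r *\<^sub>R B z x"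
  shows "bilinear B"
  using assms by (auto simp: bilinear_def intro!: linearI)

locale hermitian_form =
  fixes h :: "complex^'n::finite \<Rightarrow> complex^'n \<Rightarrow> real"
  assumes bilinear: "bilinear h"
    and sym: "h u v = h v u"
    and pos: "u \<noteq> 0 \<Longrightarrow> h u u > 0"
    and J_invariant: "h (J u) (J v) = h u v"
begin

lemmas h_linear =
  bilinear_ladd [OF bilinear] bilinear_radd [OF bilinear] bilinear_lmul [OF bilinear]
  bilinear_rmul [OF bilinear] bilinear_lneg [OF bilinear] bilinear_rneg [OF bilinear]
  bilinear_lsub [OF bilinear] bilinear_rsub [OF bilinear]

lemma h_zero [simp]: "h 0 v = 0" "h v 0 = 0"
  by (rule bilinear_lzero [OF bilinear] bilinear_rzero [OF bilinear])+

lemma linear_left: "linear (\<lambda>u. h u v)"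
  using bilinear by (auto simp: bilinear_def)

lemma h_sum_left: "h (\<Sum>i\<in>I. f i) v = (\<Sum>i\<in>I. h (f i) v)"
  by (rule linear_sum [OF linear_left])

lemma h_J_left: "h (J u) v = - h u (J v)"
  using J_invariant [of u "J v"] by (simp add: h_linear)

lemma h_J_self [simp]: "h u (J u) = 0" "h (J u) u = 0"
  using h_J_left [of u u] sym [of u "J u"] by auto

lemma h_self_eq_0_iff: "h u u = 0 \<longleftrightarrow> u = 0"
  using pos [of u] by force

lemma eqI_h:
  assumes "\<And>z. h u z = h v z"
  shows "u = v"
proof -
  have "h (u - v) (u - v) = 0"
    using assms by (simp add: h_linear)
  then show ?thesis
    by (simp add: h_self_eq_0_iff)
qed

text \<open>Frames are indexed by an arbitrary set, because an orthonormal frame comes enumerated by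
  numbers, whereas a unitary one yields a frame enumerated by pairs.\<close>
definition frame :: "'i set \<Rightarrow> ('i \<Rightarrow> complex^'n) \<Rightarrow> bool" where
  "frame I e \<longleftrightarrow> finite I \<and> card I = 2 * CARD('n) \<and>
     (\<forall>\<alpha>\<in>I. \<forall>\<beta>\<in>I. h (e \<alpha>) (e \<beta>) = (if \<alpha> = \<beta> then 1 else 0))"

text \<open>An orthonormal family is independent, so by counting it spans; the difference of the two sides is
  then orthogonal to everything.\<close>
lemma frame_expansion:
  assumes "frame I e"
  shows "(\<Sum>\<alpha>\<in>I. h v (e \<alpha>) *\<^sub>R e \<alpha>) = v"
proof -
  have fin: "finite I" and card: "card I = 2 * CARD('n)"
    and on: "\<And>\<alpha> \<beta>. \<alpha> \<in> I \<Longrightarrow> \<beta> \<in> I \<Longrightarrow> h (e \<alpha>) (e \<beta>) = (if \<alpha> = \<beta> then 1 else 0)"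
    using assms by (auto simp: frame_def)
  have inj: "inj_on e I"
    by (rule inj_onI) (metis on zero_neq_one)
  have "independent (e ` I)"
  proof (rule real_vector.independent_if_scalars_zero)
    fix c x assume 0: "(\<Sum>x\<in>e ` I. c x *\<^sub>R x) = 0" and "x \<in> e ` I"
    then obtain \<beta> where \<beta>: "\<beta> \<in> I" "x = e \<beta>" by auto
    have "0 = h (\<Sum>\<alpha>\<in>I. c (e \<alpha>) *\<^sub>R e \<alpha>) (e \<beta>)"
      using 0 by (simp add: sum.reindex [OF inj])
    also have "\<dots> = (\<Sum>\<alpha>\<in>I. if \<alpha> = \<beta> then c (e \<alpha>) else 0)"
      unfolding h_sum_left by (intro sum.cong refl) (use \<beta> on in \<open>auto simp: h_linear\<close>)
    finally show "c x = 0"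
      using \<beta> fin by simp
  qed (use fin in auto)
  moreover have "card (e ` I) = DIM(complex^'n)"
    using card inj by (simp add: card_image)
  ultimately have span: "span (e ` I) = UNIV"
    by (metis card_ge_dim_independent dim_UNIV order_refl subset_UNIV top.extremum_uniqueI)
  define r where "r = v - (\<Sum>\<alpha>\<in>I. h v (e \<alpha>) *\<^sub>R e \<alpha>)"
  have "h r (e \<beta>) = 0" if "\<beta> \<in> I" for \<beta>
  proof -
    have "h (\<Sum>\<alpha>\<in>I. h v (e \<alpha>) *\<^sub>R e \<alpha>) (e \<beta>) = (\<Sum>\<alpha>\<in>I. if \<alpha> = \<beta> then h v (e \<alpha>) else 0)"
      unfolding h_sum_left by (intro sum.cong refl) (use that on in \<open>auto simp: h_linear\<close>)
    then show ?thesis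
      using that fin by (simp add: r_def h_linear)
  qed
  have "h r w = 0" if "w \<in> span (e ` I)" for w
    using that \<open>\<And>\<beta>. \<beta> \<in> I \<Longrightarrow> h r (e \<beta>) = 0\<close>
    by (induction w rule: span_induct_alt) (auto simp: h_linear)
  then have "r = 0"
    by (simp add: span flip: h_self_eq_0_iff)
  then show ?thesis
    by (simp add: r_def)
qed

lemma frame_sum_pairing:
  assumes "frame I e" "linear F"
  shows "(\<Sum>\<alpha>\<in>I. h z (e \<alpha>) *\<^sub>R F (e \<alpha>)) = F z"
  by (subst (2) frame_expansion [OF assms(1), of z, symmetric])
     (simp add: linear_sum [OF assms(2)] linear_scale [OF assms(2)])

lemma frame_J:
  assumes "frame I e"
  shows "frame I (\<lambda>\<alpha>. J (e \<alpha>))"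
  using assms by (simp add: frame_def J_invariant)

text \<open>The trace of an endomorphism does not depend on the inner product.  This gives both the
  independence of metric traces of the frame and, for a family of inner products, an expression
  in which no frame varies with the point.\<close>
lemma sum_frame_eq_Basis_sum:
  assumes "frame I e" and A: "linear A"
  shows "(\<Sum>\<alpha>\<in>I. h (A (e \<alpha>)) (e \<alpha>)) = (\<Sum>b\<in>Basis. A b \<bullet> b)"
proof -
  have "(\<Sum>\<alpha>\<in>I. h (A (e \<alpha>)) (e \<alpha>)) = (\<Sum>\<alpha>\<in>I. \<Sum>b\<in>Basis. (e \<alpha> \<bullet> b) * h (A b) (e \<alpha>))"
  proof (intro sum.cong refl)
    fix \<alpha>
    have "A (e \<alpha>) = (\<Sum>b\<in>Basis. (e \<alpha> \<bullet> b) *\<^sub>R A b)"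
      by (subst (1) euclidean_representation [of "e \<alpha>", symmetric])
         (simp only: linear_sum [OF A] linear_scale [OF A])
    then show "h (A (e \<alpha>)) (e \<alpha>) = (\<Sum>b\<in>Basis. (e \<alpha> \<bullet> b) * h (A b) (e \<alpha>))"
      by (simp add: h_sum_left h_linear)
  qed
  also have "\<dots> = (\<Sum>b\<in>Basis. (\<Sum>\<alpha>\<in>I. h (A b) (e \<alpha>) *\<^sub>R e \<alpha>) \<bullet> b)"
    by (subst sum.swap) (simp add: inner_sum_left mult.commute)
  finally show ?thesis
    by (simp add: frame_expansion [OF assms(1)])
qed

text \<open>Gram-Schmidt over the complex numbers: as long as the vectors \<open>e i\<close>, \<open>J (e i)\<close> do not span, a
  vector outside their span is projected to their orthogonal complement and normalised.\<close>
lemma exists_partial_unitary: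
  "\<exists>e. \<forall>i\<in>S. \<forall>j\<in>S. h (e i) (e j) = (if i = j then 1 else 0) \<and> h (e i) (J (e j)) = 0"
  if "finite S" for S :: "'n set"
  using that
proof (induction S rule: finite_induct)
  case (insert k S)
  then obtain e where e: "\<And>i j. i \<in> S \<Longrightarrow> j \<in> S \<Longrightarrow> h (e i) (e j) = (if i = j then 1 else 0)"
      "\<And>i j. i \<in> S \<Longrightarrow> j \<in> S \<Longrightarrow> h (e i) (J (e j)) = 0"
    by blast
  define W where "W = e ` S \<union> (\<lambda>i. J (e i)) ` S"
  have "card W \<le> card S + card S"
    unfolding W_def
    by (meson add_mono card_Un_le card_image_le insert.hyps(1) le_trans)
  also have "\<dots> < 2 * CARD('n)"
  proof -
    have "S \<noteq> UNIV"
      using insert.hyps by blast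
    then show ?thesis
      using psubset_card_mono [of UNIV S] by (simp add: psubset_eq)
  qed
  finally have "dim W < DIM(complex^'n)"
    using dim_le_card' [of W] insert.hyps(1) by (simp add: W_def)
  then have "span W \<noteq> UNIV"
    by (metis dim_UNIV dim_span less_irrefl)
  then obtain v where v: "v \<notin> span W"
    by auto
  define p where "p = (\<Sum>i\<in>S. h v (e i) *\<^sub>R e i + h v (J (e i)) *\<^sub>R J (e i))"
  define r where "r = v - p"
  have "p \<in> span W"
    unfolding p_def W_def by (intro span_sum span_add span_scale span_base) auto
  then have r0: "r \<noteq> 0"
    using v by (auto simp: r_def)
  have "h p (e j) = (\<Sum>i\<in>S. if i = j then h v (e i) else 0)" if "j \<in> S" for j
    unfolding p_def h_sum_left
    by (intro sum.cong refl) (use e that in \<open>auto simp: h_linear h_J_left\<close>)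
  then have r1: "h r (e j) = 0" if "j \<in> S" for j
    using that insert.hyps by (simp add: r_def h_linear)
  have "h p (J (e j)) = (\<Sum>i\<in>S. if i = j then h v (J (e i)) else 0)" if "j \<in> S" for j
    unfolding p_def h_sum_left
    by (intro sum.cong refl) (use e that in \<open>auto simp: h_linear J_invariant\<close>)
  then have r2: "h r (J (e j)) = 0" if "j \<in> S" for j
    using that insert.hyps by (simp add: r_def h_linear)
  have r3: "h (e j) r = 0" "h (e j) (J r) = 0" if "j \<in> S" for j
    using r1 [OF that] r2 [OF that] sym [of "e j" r] sym [of "e j" "J r"] h_J_left [of r "e j"] by auto
  define s where "s = (1 / sqrt (h r r)) *\<^sub>R r"
  have s: "h s s = 1"
    using pos [OF r0] by (simp add: s_def h_linear)
  have s': "h s (e j) = 0" "h s (J (e j)) = 0" "h (e j) s = 0" "h (e j) (J s) = 0" if "j \<in> S" for j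
    using that by (simp_all add: s_def h_linear J_linear r1 r2 r3)
  show ?case
    by (rule exI [of _ "e(k := s)"]) (use e s s' insert.hyps in \<open>auto\<close>)
qed auto

lemma exists_unitary:
  "\<exists>e :: 'n \<Rightarrow> complex^'n. \<forall>i j. h (e i) (e j) = (if i = j then 1 else 0) \<and>
     h (J (e i)) (J (e j)) = (if i = j then 1 else 0) \<and> h (e i) (J (e j)) = 0"
  using exists_partial_unitary [of UNIV] by (simp add: J_invariant)

lemma unitary_imp_frame:
  assumes "\<And>i j. h (e i) (e j) = (if i = j then 1 else 0)" "\<And>i j. h (e i) (J (e j)) = 0"
  shows "frame (UNIV :: ('n \<times> bool) set) (\<lambda>(i, b). if b then J (e i) else e i)"
  using assms by (auto simp: frame_def J_invariant h_J_left h_linear)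

lemma exists_product_frame: "\<exists>e. frame (UNIV :: ('n \<times> bool) set) e"
  using exists_unitary unitary_imp_frame by metis

lemma exists_nat_frame: "\<exists>e. frame {..<2 * CARD('n)} e"
proof -
  obtain e where e: "frame (UNIV :: ('n \<times> bool) set) e"
    using exists_product_frame by blast
  obtain \<phi> :: "nat \<Rightarrow> 'n \<times> bool" where "bij_betw \<phi> {..<2 * CARD('n)} UNIV"
    using finite_same_card_bij [of "{..<2 * CARD('n)}" "UNIV :: ('n \<times> bool) set"] by auto
  then have "frame {..<2 * CARD('n)} (e \<circ> \<phi>)"
    using e unfolding frame_def bij_betw_def by (auto simp: inj_on_eq_iff simp del: split_paired_All)
  then show ?thesis
    by blast
qed

lemma riesz: 
  assumes "linear l"
  shows "\<exists>!w. \<forall>z. h w z = l z"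
proof -
  obtain e where e: "frame {..<2 * CARD('n)} e"
    using exists_nat_frame by blast
  have "h (\<Sum>\<alpha><2 * CARD('n). l (e \<alpha>) *\<^sub>R e \<alpha>) z = l z" for z
    using frame_sum_pairing [OF e assms, of z] by (simp add: h_sum_left h_linear mult.commute sym [of z])
  then show ?thesis
    by (metis eqI_h)
qed

end

section \<open>Traces with respect to a metric\<close>

text \<open>The base point \<open>0\<close> is a dummy: the field of inner products is constant.\<close>
definition metric_trace ::
    "(complex^'n::finite \<Rightarrow> complex^'n \<Rightarrow> real) \<Rightarrow> (complex^'n \<Rightarrow> complex^'n \<Rightarrow> real) \<Rightarrow> real" where
  "metric_trace h B =
     (let e = some_orthonormal_frame (\<lambda>_. h) 0 in \<Sum>\<alpha><2 * CARD('n). B (e \<alpha>) (e \<alpha>))"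

lemma metric_trace_add:
    "metric_trace h (\<lambda>u v. B u v + C u v) = metric_trace h B + metric_trace h C"
  and metric_trace_diff:
    "metric_trace h (\<lambda>u v. B u v - C u v) = metric_trace h B - metric_trace h C"
  and metric_trace_cmult: "metric_trace h (\<lambda>u v. r * B u v) = r * metric_trace h B"
  and metric_trace_transpose: "metric_trace h (\<lambda>u v. B v u) = metric_trace h B"
  by (simp_all add: metric_trace_def Let_def sum.distrib sum_subtractf sum_distrib_left)

context hermitian_form
begin

lemma frame_some_orthonormal_frame:
  "frame {..<2 * CARD('n)} (some_orthonormal_frame (\<lambda>_. h) 0)"
proof -
  obtain e where "frame {..<2 * CARD('n)} e"
    using exists_nat_frame by blast
  then have "orthonormal_frame (\<lambda>_. h) 0 e"
    by (simp add: frame_def orthonormal_frame_def)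
  then have "orthonormal_frame (\<lambda>_. h) 0 (some_orthonormal_frame (\<lambda>_. h) 0)"
    unfolding some_orthonormal_frame_def by (metis someI_ex)
  then show ?thesis
    by (auto simp: frame_def orthonormal_frame_def)
qed

text \<open>Write \<open>B u v = h (A u) v\<close>; then both sides are the trace of \<open>A\<close>.\<close>
lemma metric_trace_eq_sum:
  assumes e: "frame I e" and B: "bilinear B"
  shows "metric_trace h B = (\<Sum>\<alpha>\<in>I. B (e \<alpha>) (e \<alpha>))"
proof -
  have "\<forall>u. \<exists>w. \<forall>z. h w z = B u z"
    using riesz B by (fastforce simp: bilinear_def)
  then obtain A where A: "\<And>u z. h (A u) z = B u z"
    by metis
  have "linear A"
    by (intro linearI eqI_h) (simp_all add: h_linear A bilinear_ladd [OF B] bilinear_lmul [OF B])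
  then show ?thesis
    using sum_frame_eq_Basis_sum [OF e, of A]
      sum_frame_eq_Basis_sum [OF frame_some_orthonormal_frame, of A]
    by (simp add: metric_trace_def Let_def A)
qed

lemma metric_trace_endomorphism:
  assumes "linear A"
  shows "metric_trace h (\<lambda>u v. h (A u) v) = (\<Sum>b\<in>Basis. A b \<bullet> b)"
  using sum_frame_eq_Basis_sum [OF frame_some_orthonormal_frame assms]
  by (simp add: metric_trace_def Let_def)

lemma metric_trace_contract:
  assumes "linear \<beta>"
  shows "metric_trace h (\<lambda>u v. \<beta> u * h v z) = \<beta> z"
  using frame_sum_pairing [OF frame_some_orthonormal_frame assms, of z]
  by (simp add: metric_trace_def Let_def mult.commute sym [of z])

lemma metric_trace_self: "metric_trace h h = 2 * real CARD('n)"
  using frame_some_orthonormal_frame by (simp add: metric_trace_def Let_def frame_def)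

lemma metric_trace_J:
  assumes "bilinear B"
  shows "metric_trace h (\<lambda>u v. B (J u) (J v)) = metric_trace h B"
  using metric_trace_eq_sum [OF frame_J [OF frame_some_orthonormal_frame] assms]
  by (simp add: metric_trace_def Let_def)

lemma hermitian_form_scale:
  assumes "s > 0"
  shows "hermitian_form (\<lambda>u v. s * h u v)"
proof
  show "bilinear (\<lambda>u v. s * h u v)"
    by (rule bilinearI) (simp_all add: h_linear algebra_simps)
qed (use assms sym pos J_invariant in auto)

text \<open>If \<open>e\<close> is a frame for \<open>h\<close>, then \<open>s\<^sup>-\<^sup>1\<^sup>/\<^sup>2 e\<close> is one for \<open>s h\<close>.\<close>
lemma metric_trace_scale:
  assumes "s > 0" "bilinear B"
  shows "metric_trace (\<lambda>u v. s * h u v) B = metric_trace h B / s"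
proof -
  interpret s: hermitian_form "\<lambda>u v. s * h u v"
    using assms(1) by (rule hermitian_form_scale)
  define e where "e = some_orthonormal_frame (\<lambda>_. h) 0"
  have e: "frame {..<2 * CARD('n)} e"
    unfolding e_def by (rule frame_some_orthonormal_frame)
  have "s.frame {..<2 * CARD('n)} (\<lambda>\<alpha>. (1 / sqrt s) *\<^sub>R e \<alpha>)"
    using e assms(1) by (auto simp: frame_def s.frame_def h_linear)
  from s.metric_trace_eq_sum [OF this assms(2)] show ?thesis
    unfolding metric_trace_eq_sum [OF e assms(2)] sum_divide_distrib using assms
    by (simp add: bilinear_lmul bilinear_rmul field_simps)
qed

text \<open>A unitary frame \<open>e\<close> gives the orthonormal frame of the \<open>e i\<close> and \<open>J (e i)\<close>, and the two halves
  contribute equally.\<close>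
lemma unitary_sum_eq_half_metric_trace:
  assumes "unitary_frame (\<lambda>_. h) x e" and B: "bilinear B" and J: "\<And>u. B (J u) (J u) = B u u"
  shows "(\<Sum>i\<in>UNIV. B (e i) (e i)) = metric_trace h B / 2"
proof -
  have "frame UNIV (\<lambda>(i, b). if b then J (e i) else e i)"
    using assms(1) by (intro unitary_imp_frame) (auto simp: unitary_frame_def)
  from metric_trace_eq_sum [OF this B]
  have "metric_trace h B = (\<Sum>p\<in>UNIV \<times> (UNIV::bool set). B (e (fst p)) (e (fst p)))"
    unfolding UNIV_Times_UNIV by (simp add: J case_prod_unfold if_distrib [of "\<lambda>w. B w w"] cong: if_cong)
  also have "\<dots> = (\<Sum>i\<in>UNIV. \<Sum>b\<in>(UNIV::bool set). B (e i) (e i))"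
    by (subst sum.cartesian_product) (simp add: case_prod_unfold)
  finally show ?thesis
    by (simp add: sum_distrib_left [symmetric])
qed

lemma unitary_some_unitary_frame: "unitary_frame (\<lambda>_. h) x (some_unitary_frame (\<lambda>_. h) x)"
proof -
  have "\<exists>e. unitary_frame (\<lambda>_. h) x e"
    using exists_unitary by (simp add: unitary_frame_def)
  then show ?thesis
    unfolding some_unitary_frame_def by (metis someI_ex)
qed

text \<open>Write \<open>T' = T + S/2\<close>, so that \<open>|T'|\<^sup>2 = |T|\<^sup>2 + \<langle>T,S\<rangle> + |S|\<^sup>2/4\<close>.  Paired with any of the four terms of
  \<open>S\<close>, the tensor \<open>T\<close> is contracted to its trace \<open>\<theta>\<close>, by antisymmetry and complex linearity, so
  \<open>\<langle>T,S\<rangle>\<close> is four times the pairing of \<open>a\<close> with \<open>\<theta>\<close>.  In \<open>|S|\<^sup>2\<close> the four squares give \<open>2n |a|\<^sup>2\<close> each,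
  and the mixed products sum to \<open>-8 |a|\<^sup>2\<close>.\<close>
lemma torsion_norm_conformal:
  fixes T :: "complex^'n \<Rightarrow> complex^'n \<Rightarrow> complex^'n" and a \<theta> :: "complex^'n \<Rightarrow> real"
  assumes T: "bilinear T" "\<And>u v. T u v = - T v u" "\<And>u v. T (J u) v = J (T u v)"
    and a: "linear a"
    and \<theta>: "\<And>v. \<theta> v = metric_trace h (\<lambda>u w. h (T v u) w)"
    and T': "\<And>u v. T' u v = T u v +
        (1/2) *\<^sub>R (a u *\<^sub>R v - a (J u) *\<^sub>R J v - a v *\<^sub>R u + a (J v) *\<^sub>R J u)"
  shows "metric_trace h (\<lambda>u u'. metric_trace h (\<lambda>v v'. h (T' u v) (T' u' v'))) =
     metric_trace h (\<lambda>u u'. metric_trace h (\<lambda>v v'. h (T u v) (T u' v')))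
     + 4 * metric_trace h (\<lambda>u v. a u * \<theta> v)
     + 2 * (real CARD('n) - 1) * metric_trace h (\<lambda>u v. a u * a v)"
proof -
  let ?I = "{..<2 * CARD('n)}"
  define e where "e = some_orthonormal_frame (\<lambda>_. h) 0"
  have e: "frame ?I e"
    unfolding e_def by (rule frame_some_orthonormal_frame)
  have tr: "metric_trace h B = (\<Sum>\<alpha>\<in>?I. B (e \<alpha>) (e \<alpha>))" for B
    by (simp add: metric_trace_def Let_def e_def)
  have T_J: "T u (J v) = J (T u v)" for u v
    by (metis T(2,3) J_minus)
  have contract: "(\<Sum>\<beta>\<in>?I. l (e \<beta>) * h (e \<beta>) z) = l z" if "linear l" for l z
    using metric_trace_contract [OF that, of z] by (simp add: tr)
  have aJ: "linear (\<lambda>v. a (J v))"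
    using linear_compose [OF linear_J a] by (simp add: o_def)
  note a_linear = linear_add [OF a] linear_scale [OF a] linear_neg [OF a]
  define Q where "Q = (\<Sum>\<alpha>\<in>?I. a (e \<alpha>) * a (e \<alpha>))"
  define P where "P = (\<Sum>\<alpha>\<in>?I. a (e \<alpha>) * \<theta> (e \<alpha>))"
  have QJ: "(\<Sum>\<alpha>\<in>?I. a (J (e \<alpha>)) * a (J (e \<alpha>))) = Q"
  proof -
    have "bilinear (\<lambda>u v. a u * a v)"
      by (rule bilinearI) (simp_all add: a_linear algebra_simps)
    from metric_trace_J [OF this] show ?thesis
      by (simp add: tr Q_def)
  qed
  note T_linear = bilinear_ladd [OF T(1)] bilinear_lmul [OF T(1)]
  have \<theta>_sum: "\<theta> v = (\<Sum>\<beta>\<in>?I. h (T v (e \<beta>)) (e \<beta>))" for v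
    by (simp add: \<theta> tr)
  have PJ: "(\<Sum>\<alpha>\<in>?I. a (J (e \<alpha>)) * \<theta> (J (e \<alpha>))) = P"
  proof -
    have "bilinear (\<lambda>u v. a u * \<theta> v)"
      by (rule bilinearI) (simp_all add: \<theta>_sum T_linear h_linear sum.distrib sum_distrib_left a_linear algebra_simps)
    from metric_trace_J [OF this] show ?thesis
      by (simp add: tr P_def)
  qed
  \<comment> \<open>\<open>X\<close> is the cross term, \<open>1/4 * Y\<close> the square of the added tensor.\<close>
  define X where "X u v = a u * h (T u v) v + a (J u) * h (T (J u) v) v
      + a v * h (T v u) u + a (J v) * h (T (J v) u) u" for u v
  define Y where "Y u v = (a u * a u + a (J u) * a (J u)) * h v v
      + (a v * a v + a (J v) * a (J v)) * h u u
      - 2 * a u * (a v * h v u) + 2 * a u * (a (J v) * h v (J u))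
      - 2 * a (J u) * (a v * h v (J u)) - 2 * a (J u) * (a (J v) * h v u)" for u v
  have point: "h (T' u v) (T' u v) = h (T u v) (T u v) + X u v + 1/4 * Y u v" for u v
  proof -
    have 1: "h (T u v) (J v) = - h (T (J u) v) v" "h (T u v) u = - h (T v u) u"
        "h (T u v) (J u) = h (T (J v) u) u"
      using h_J_left T(2) [of u v] T(2) [of u "J v"] 
      by (simp_all add: T(3) T_J h_linear J_linear)
    have 2: "h u v = h v u" "h (J u) v = h v (J u)" "h u (J v) = - h v (J u)" "h (J v) u = - h v (J u)"
      "h (J u) (J v) = h v u" "h (J v) (J u) = h v u" "h v (T u v) = h (T u v) v" 
      "h (J v) (T u v) = h (T u v) (J v)" "h u (T u v) = h (T u v) u" "h (J u) (T u v) = h (T u v) (J u)"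
      using sym h_J_left J_invariant by metis+
    show ?thesis
      unfolding T' X_def Y_def by (simp add: h_linear 1 2 J_invariant) (simp add: field_simps)
  qed
  have \<theta>_swap: "(\<Sum>\<alpha>\<in>?I. \<Sum>\<beta>\<in>?I. b (e \<beta>) * h (T (K (e \<beta>)) (e \<alpha>)) (e \<alpha>))
       = (\<Sum>\<beta>\<in>?I. b (e \<beta>) * \<theta> (K (e \<beta>)))" for b K
    by (subst sum.swap) (simp add: \<theta>_sum sum_distrib_left)
  have card: "(\<Sum>\<beta>\<in>?I. h (e \<beta>) (e \<beta>)) = 2 * real CARD('n)"
    using metric_trace_self by (simp add: tr)
  have Y_sum: "(\<Sum>\<beta>\<in>?I. Y u (e \<beta>)) =
      (2 * real CARD('n) - 4) * (a u * a u + a (J u) * a (J u)) + 2 * Q * h u u" (is "?L = _") for u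
  proof -
    have "?L = (a u * a u + a (J u) * a (J u)) * (2 * real CARD('n)) + (Q + Q) * h u u
        - 2 * a u * a u + 2 * a u * a (J (J u)) - 2 * a (J u) * a (J u) - 2 * a (J u) * a (J u)"
      unfolding Y_def sum.distrib sum_subtractf
      by (simp only: sum_distrib_left [symmetric] sum_distrib_right [symmetric] sum.distrib
          contract [OF a] contract [OF aJ] QJ card Q_def [symmetric])
    also have "\<dots> = (2 * real CARD('n) - 4) * (a u * a u + a (J u) * a (J u)) + 2 * Q * h u u"
      by (simp add: a_linear algebra_simps)
    finally show ?thesis .
  qed
  have X_sum: "(\<Sum>\<alpha>\<in>?I. \<Sum>\<beta>\<in>?I. X (e \<alpha>) (e \<beta>)) = P + P + P + P"
    using \<theta>_swap [of a "\<lambda>v. v"] \<theta>_swap [of "\<lambda>v. a (J v)" J] PJ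
    by (simp add: X_def P_def \<theta>_sum sum_distrib_left sum.distrib)
  have "metric_trace h (\<lambda>u u'. metric_trace h (\<lambda>v v'. h (T' u v) (T' u' v'))) =
      (\<Sum>\<alpha>\<in>?I. \<Sum>\<beta>\<in>?I. h (T (e \<alpha>) (e \<beta>)) (T (e \<alpha>) (e \<beta>)))
      + (\<Sum>\<alpha>\<in>?I. \<Sum>\<beta>\<in>?I. X (e \<alpha>) (e \<beta>)) + 1/4 * (\<Sum>\<alpha>\<in>?I. \<Sum>\<beta>\<in>?I. Y (e \<alpha>) (e \<beta>))"
    by (simp add: tr point sum.distrib sum_distrib_left)
  also have "(\<Sum>\<alpha>\<in>?I. \<Sum>\<beta>\<in>?I. Y (e \<alpha>) (e \<beta>)) =
      (2 * real CARD('n) - 4) * (Q + Q) + 2 * Q * (2 * real CARD('n))"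
    unfolding Y_sum
    by (simp only: sum.distrib sum_distrib_left [symmetric] QJ card Q_def [symmetric])
  finally show ?thesis
    unfolding tr P_def [symmetric] Q_def [symmetric] X_sum by (simp add: algebra_simps)
qed

end

section \<open>Rules for derivatives\<close>

text \<open>The two functions have the same derivatives at \<open>x\<close>, so the same one is chosen, or the same arbitrary
  value if there is none.\<close>
lemma frechet_derivative_cong_open:
  assumes "open U" "x \<in> U" "\<And>y. y \<in> U \<Longrightarrow> f y = f' y"
  shows "frechet_derivative f (at x) = frechet_derivative f' (at x)"
proof -
  have "(f has_derivative D) (at x) = (f' has_derivative D) (at x)" for D
    using assms by (auto elim!: has_derivative_transform_within_open)
  then show ?thesis
    by (simp add: frechet_derivative_def)
qed

lemma differentiable_cong_open:
  assumes "open U" "x \<in> U" "\<And>y. y \<in> U \<Longrightarrow> f y = f' y" "f' differentiable (at x)"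
  shows "f differentiable (at x)"
  using assms unfolding differentiable_def
  by (metis has_derivative_transform_within_open)

lemma frechet_derivative_plus:
  assumes "f differentiable (at x)" "k differentiable (at x)"
  shows "frechet_derivative (\<lambda>y. f y + k y) (at x) v =
    frechet_derivative f (at x) v + frechet_derivative k (at x) v"
  by (simp add: frechet_derivative_at
      [OF has_derivative_add [OF assms [unfolded frechet_derivative_works]], symmetric])

lemma frechet_derivative_minus:
  assumes "f differentiable (at x)" "k differentiable (at x)"
  shows "frechet_derivative (\<lambda>y. f y - k y) (at x) v =
    frechet_derivative f (at x) v - frechet_derivative k (at x) v"
  by (simp add: frechet_derivative_at
      [OF has_derivative_diff [OF assms [unfolded frechet_derivative_works]], symmetric])

lemma frechet_derivative_linear_image:
  assumes "bounded_linear A" "f differentiable (at x)"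
  shows "frechet_derivative (\<lambda>y. A (f y)) (at x) v = A (frechet_derivative f (at x) v)"
  by (simp add: frechet_derivative_at
      [OF bounded_linear.has_derivative [OF assms [unfolded frechet_derivative_works]], symmetric])

lemma frechet_derivative_mult:
  fixes f k :: "'a::real_normed_vector \<Rightarrow> real"
  assumes "f differentiable (at x)" "k differentiable (at x)"
  shows "frechet_derivative (\<lambda>y. f y * k y) (at x) v =
    f x * frechet_derivative k (at x) v + frechet_derivative f (at x) v * k x"
  by (simp add: frechet_derivative_at
      [OF has_derivative_mult [OF assms [unfolded frechet_derivative_works]], symmetric])

lemma has_derivative_exp_cmult:
  fixes F :: "'a::real_normed_vector \<Rightarrow> real"
  assumes "F differentiable (at x)"
  shows "((\<lambda>y. exp (k * F y)) has_derivative
    (\<lambda>v. k * exp (k * F x) * frechet_derivative F (at x) v)) (at x)"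
  by (rule derivative_eq_intros refl assms [unfolded frechet_derivative_works])+
     (simp add: algebra_simps)

lemma frechet_derivative_exp_cmult:
  fixes F :: "'a::real_normed_vector \<Rightarrow> real"
  assumes "F differentiable (at x)"
  shows "frechet_derivative (\<lambda>y. exp (k * F y)) (at x) v =
    k * exp (k * F x) * frechet_derivative F (at x) v"
  by (simp add: frechet_derivative_at [OF has_derivative_exp_cmult [OF assms, of k], symmetric])

lemma differentiable_prod:
  fixes f :: "'i \<Rightarrow> 'a::real_normed_vector \<Rightarrow> real"
  assumes "\<And>i. i \<in> I \<Longrightarrow> f i differentiable (at x)"
  shows "(\<lambda>y. \<Prod>i\<in>I. f i y) differentiable (at x)"
  using assms by (induction I rule: infinite_finite_induct) (auto intro!: differentiable_mult)

lemma differentiable_det: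
  fixes A :: "'a::real_normed_vector \<Rightarrow> real^'m::finite^'m"
  assumes "\<And>i j. (\<lambda>y. A y $ i $ j) differentiable (at x)"
  shows "(\<lambda>y. det (A y)) differentiable (at x)"
  unfolding det_def
  by (intro differentiable_sum ballI differentiable_mult differentiable_const differentiable_prod assms)
     (auto simp: finite_permutations)

section \<open>The Chern connection in a holomorphic chart\<close>

text \<open>The Chern curvature differentiates the connection, which contains first derivatives of the metric;
  hence the metric is assumed to be twice differentiable.\<close>
locale hermitian_chart =
  fixes U :: "(complex^'n::finite) set" and g :: "'n tensor2"
  assumes open_U: "open U"
    and hermitian: "x \<in> U \<Longrightarrow> hermitian_form (g x)"
    and differentiable_g: "x \<in> U \<Longrightarrow> (\<lambda>y. g y u v) differentiable (at x)"
    and differentiable_dg: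
      "x \<in> U \<Longrightarrow> (\<lambda>y. frechet_derivative (\<lambda>z. g z u v) (at y) w) differentiable (at x)"
begin

lemma g_linear:
  assumes "x \<in> U"
  shows "g x (u + u') v = g x u v + g x u' v" "g x v (u + u') = g x v u + g x v u'"
    "g x (r *\<^sub>R u) v = r * g x u v" "g x v (r *\<^sub>R u) = r * g x v u"
    "g x (- u) v = - g x u v" "g x v (- u) = - g x v u"
    "g x (u - u') v = g x u v - g x u' v" "g x v (u - u') = g x v u - g x v u'"
    "g x 0 v = 0" "g x v 0 = 0"
proof -
  interpret hermitian_form "g x" using hermitian assms .
  show "g x (u + u') v = g x u v + g x u' v" "g x v (u + u') = g x v u + g x v u'"
    "g x (r *\<^sub>R u) v = r * g x u v" "g x v (r *\<^sub>R u) = r * g x v u"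
    "g x (- u) v = - g x u v" "g x v (- u) = - g x v u"
    "g x (u - u') v = g x u v - g x u' v" "g x v (u - u') = g x v u - g x v u'"
    "g x 0 v = 0" "g x v 0 = 0"
    by (simp_all add: h_linear)
qed

lemma g_sym: "x \<in> U \<Longrightarrow> g x u v = g x v u"
  using hermitian hermitian_form.sym by blast

lemma g_J: "x \<in> U \<Longrightarrow> g x (J u) (J v) = g x u v"
  using hermitian hermitian_form.J_invariant by blast

lemma g_J_left: "x \<in> U \<Longrightarrow> g x (J u) v = - g x u (J v)"
  using hermitian hermitian_form.h_J_left by blast

lemma g_eqI: "x \<in> U \<Longrightarrow> (\<And>z. g x u z = g x v z) \<Longrightarrow> u = v"
  using hermitian hermitian_form.eqI_h by blast

lemma g_sharp: "x \<in> U \<Longrightarrow> linear l \<Longrightarrow> g x (sharp g x l) z = l z"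
  unfolding sharp_def using theI' [OF hermitian_form.riesz [OF hermitian]] by blast

lemma sharp_eqI: "x \<in> U \<Longrightarrow> (\<And>z. g x w z = l z) \<Longrightarrow> sharp g x l = w"
  unfolding sharp_def by (rule the_equality) (auto intro: g_eqI)

definition dg :: "complex^'n \<Rightarrow> complex^'n \<Rightarrow> complex^'n \<Rightarrow> complex^'n \<Rightarrow> real" where
  "dg x u v w = frechet_derivative (\<lambda>y. g y v w) (at x) u"

lemma differentiable_dg': "x \<in> U \<Longrightarrow> (\<lambda>y. dg y u v w) differentiable (at x)"
  unfolding dg_def by (rule differentiable_dg)

lemma dg_linear:
  assumes x: "x \<in> U"
  shows "dg x (u + u') v w = dg x u v w + dg x u' v w" "dg x (r *\<^sub>R u) v w = r * dg x u v w"
    "dg x u (v + v') w = dg x u v w + dg x u v' w" "dg x u (r *\<^sub>R v) w = r * dg x u v w"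
    "dg x u v (w + w') = dg x u v w + dg x u v w'" "dg x u v (r *\<^sub>R w) = r * dg x u v w"
    "dg x (- u) v w = - dg x u v w" "dg x u (- v) w = - dg x u v w" "dg x u v (- w) = - dg x u v w"
proof -
  have lin: "linear (\<lambda>u. dg x u v w)" for v w
    unfolding dg_def using linear_frechet_derivative [OF differentiable_g [OF x]] by simp
  have add1: "dg x u (v + v') w = dg x u v w + dg x u v' w"
    and add2: "dg x u v (w + w') = dg x u v w + dg x u v w'" for u v v' w w'
    unfolding dg_def frechet_derivative_plus [OF differentiable_g [OF x] differentiable_g [OF x], symmetric]
    by (rule fun_cong [OF frechet_derivative_cong_open [OF open_U x]], simp add: g_linear)+
  have scale1: "dg x u (r *\<^sub>R v) w = r * dg x u v w"
    and scale2: "dg x u v (r *\<^sub>R w) = r * dg x u v w" for r u v w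
    unfolding dg_def
      frechet_derivative_linear_image [OF bounded_linear_mult_right differentiable_g [OF x], symmetric]
    by (rule fun_cong [OF frechet_derivative_cong_open [OF open_U x]], simp add: g_linear)+
  show "dg x (u + u') v w = dg x u v w + dg x u' v w" "dg x (r *\<^sub>R u) v w = r * dg x u v w"
    "dg x u (v + v') w = dg x u v w + dg x u v' w" "dg x u (r *\<^sub>R v) w = r * dg x u v w"
    "dg x u v (w + w') = dg x u v w + dg x u v w'" "dg x u v (r *\<^sub>R w) = r * dg x u v w"
    using linear_add [OF lin] linear_scale [OF lin] by (simp_all add: add1 add2 scale1 scale2)
  show "dg x (- u) v w = - dg x u v w" "dg x u (- v) w = - dg x u v w" "dg x u v (- w) = - dg x u v w"
    using linear_neg [OF lin] scale1 [of u "-1"] scale2 [of u v "-1"] by simp_all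
qed

lemma dg_sym: "x \<in> U \<Longrightarrow> dg x u v w = dg x u w v"
  unfolding dg_def
  by (rule fun_cong [OF frechet_derivative_cong_open [OF open_U]]) (simp_all add: g_sym)

lemma dg_J: "x \<in> U \<Longrightarrow> dg x u (J v) (J w) = dg x u v w"
  unfolding dg_def
  by (rule fun_cong [OF frechet_derivative_cong_open [OF open_U]]) (simp_all add: g_J)

lemma dg_J_left: "x \<in> U \<Longrightarrow> dg x u (J v) w = - dg x u v (J w)"
  using dg_J [of x u v "J w"] by (simp add: dg_linear)

lemma dg_J_self [simp]: "x \<in> U \<Longrightarrow> dg x u (J v) v = 0"
  using dg_J_left [of x u v v] dg_sym [of x u v "J v"] by simp

lemma d_fund_eq: "d_fund g x u v w = dg x u (J v) w - dg x v (J u) w + dg x w (J u) v"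
  by (simp add: d_fund_def fund_form_def dg_def)

text \<open>The Koszul formula: its right-hand side defines a connection with the properties that characterise
  the Christoffel tensor, and these properties in turn enforce it.\<close>
lemma g_christoffel:
  assumes x: "x \<in> U"
  shows "g x (christoffel g x u v) w = 1/2 * (dg x u v w + dg x v u w - dg x w u v)"
proof -
  define G where "G u v = sharp g x (\<lambda>w. 1/2 * (dg x u v w + dg x v u w - dg x w u v))" for u v
  have G: "g x (G u v) w = 1/2 * (dg x u v w + dg x v u w - dg x w u v)" for u v w
    unfolding G_def by (rule g_sharp [OF x], rule linearI) (simp_all add: dg_linear x field_simps)
  have "christoffel g x = G"
    unfolding christoffel_def
  proof (rule the_equality)
    have "bilinear G"
      by (rule bilinearI; rule g_eqI [OF x]) (simp_all add: G g_linear dg_linear x field_simps)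
    moreover have "G u v = G v u" for u v
      by (rule g_eqI [OF x]) (simp add: G dg_sym [OF x, of _ u v])
    moreover have "dg x u v w = g x (G u v) w + g x v (G u w)" for u v w
      unfolding g_sym [OF x, of v] G
      by (simp add: dg_sym [OF x, of w v u] dg_sym [OF x, of u w v] dg_sym [OF x, of v w u] field_simps)
    ultimately show "bilinear G \<and> (\<forall>u v. G u v = G v u) \<and>
        (\<forall>u v w. frechet_derivative (\<lambda>y. g y v w) (at x) u = g x (G u v) w + g x v (G u w))"
      by (simp add: dg_def)
  next
    fix H assume "bilinear H \<and> (\<forall>u v. H u v = H v u) \<and>
        (\<forall>u v w. frechet_derivative (\<lambda>y. g y v w) (at x) u = g x (H u v) w + g x v (H u w))"
    then have H: "\<And>u v. H u v = H v u" "\<And>u v w. dg x u v w = g x (H u v) w + g x v (H u w)"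
      by (auto simp: dg_def)
    show "H = G"
    proof (intro ext g_eqI [OF x])
      fix u v w
      show "g x (H u v) w = g x (G u v) w"
        unfolding G H(2) H(1) [of v u] H(1) [of w u] H(1) [of w v]
        by (simp add: g_sym [OF x, of _ "H _ _"])
    qed
  qed
  then show ?thesis
    by (simp add: G)
qed

text \<open>The Chern connection on coordinate-constant fields, see \<open>chern_connection_const\<close>.\<close>
definition chern :: "complex^'n \<Rightarrow> complex^'n \<Rightarrow> complex^'n \<Rightarrow> complex^'n" where
  "chern x u v = sharp g x (\<lambda>z. 1/2 * (dg x u v z - dg x (J u) (J v) z))"

lemma linear_chern_form: "x \<in> U \<Longrightarrow> linear (\<lambda>z. 1/2 * (dg x u v z - dg x (J u) (J v) z))"
  by (rule linearI) (simp_all add: dg_linear field_simps)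

lemma g_chern: "x \<in> U \<Longrightarrow> g x (chern x u v) z = 1/2 * (dg x u v z - dg x (J u) (J v) z)"
  unfolding chern_def by (rule g_sharp [OF _ linear_chern_form])

lemma bilinear_chern: "x \<in> U \<Longrightarrow> bilinear (chern x)"
  by (rule bilinearI; rule g_eqI, assumption) (simp_all add: g_chern g_linear dg_linear J_linear field_simps)

lemmas chern_linear =
  bilinear_ladd [OF bilinear_chern] bilinear_radd [OF bilinear_chern]
  bilinear_lmul [OF bilinear_chern] bilinear_rmul [OF bilinear_chern]
  bilinear_lneg [OF bilinear_chern] bilinear_rneg [OF bilinear_chern]
  bilinear_lsub [OF bilinear_chern] bilinear_rsub [OF bilinear_chern]
  bilinear_lzero [OF bilinear_chern]

lemma chern_J_right: "x \<in> U \<Longrightarrow> chern x u (J v) = J (chern x u v)"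
  by (rule g_eqI, assumption) (simp_all add: g_chern g_J_left dg_linear dg_J_left dg_J field_simps)

lemma chern_J_left: "x \<in> U \<Longrightarrow> chern x (J u) v = J (chern x u v)"
  by (rule g_eqI, assumption) (simp_all add: g_chern g_J_left dg_linear dg_J_left dg_J field_simps)

text \<open>In the Koszul formula minus half of \<open>d\<omega>(Ju,v,z)\<close> the derivatives of \<open>g\<close> along \<open>v\<close> and \<open>z\<close> cancel,
  which leaves the two terms that define \<open>chern\<close>.  For the curvature, \<open>V\<close> will itself be a covariant
  derivative.\<close>
lemma chern_connection_const:
  assumes x: "x \<in> U"
  shows "chern_connection g (\<lambda>_. u) V x = frechet_derivative V (at x) u + chern x u (V x)"
  unfolding chern_connection_def
proof (rule sharp_eqI [OF x])
  fix z
  show "g x (frechet_derivative V (at x) u + chern x u (V x)) z =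
      g x (levi_civita g (\<lambda>_. u) V x) z - 1/2 * d_fund g x (J u) (V x) z"
    by (simp add: levi_civita_def g_linear x g_christoffel g_chern d_fund_eq dg_linear field_simps)
qed

lemma torsion_eq: 
  assumes x: "x \<in> U"
  shows "torsion g x u v = chern x u v - chern x v u"
  unfolding torsion_def
proof (rule sharp_eqI [OF x])
  fix z
  show "g x (chern x u v - chern x v u) z =
      - 1/2 * (d_fund g x (J u) v z + d_fund g x u (J v) z)"
    by (simp add: g_linear x g_chern d_fund_eq dg_linear dg_J dg_sym [OF x, of z v u] field_simps)
qed

text \<open>In a basis that is orthonormal at \<open>x\<close>, raising an index at \<open>y\<close> means solving a linear system whose
  coefficients are differentiable in \<open>y\<close> and whose matrix is the identity for \<open>y = x\<close>.  Near \<open>x\<close>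
  Cramer's rule expresses the solution by differentiable functions.\<close>
lemma differentiable_sharp:
  assumes x: "x \<in> U" and lin: "\<And>y. y \<in> U \<Longrightarrow> linear (l y)"
    and diff: "\<And>z. (\<lambda>y. l y z) differentiable (at x)"
  shows "(\<lambda>y. sharp g y (l y)) differentiable (at x)"
proof -
  interpret hermitian_form "g x"
    using hermitian x .
  obtain e where e: "frame (UNIV :: ('n \<times> bool) set) e"
    using exists_product_frame by blast
  define G :: "complex^'n \<Rightarrow> real^('n\<times>bool)^('n\<times>bool)" where "G y = (\<chi> i j. g y (e j) (e i))" for y
  define c where "c y = (\<chi> i. g x (sharp g y (l y)) (e i))" for y
  define b where "b y = (\<chi> i. l y (e i))" for y
  define X where "X k y = (\<chi> i j. if j = k then b y $ i else G y $ i $ j)" for k y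
  have detG: "(\<lambda>y. det (G y)) differentiable (at x)"
    by (rule differentiable_det) (simp add: G_def differentiable_g x)
  have detX: "(\<lambda>y. det (X k y)) differentiable (at x)" for k
  proof (rule differentiable_det)
    fix i j
    show "(\<lambda>y. X k y $ i $ j) differentiable (at x)"
      by (cases "j = k") (simp_all add: X_def G_def b_def differentiable_g diff x)
  qed
  have "G x = mat 1"
    using e by (auto simp: G_def mat_def vec_eq_iff frame_def)
  then have "det (G x) \<noteq> 0"
    by simp
  then obtain S where S: "open S" "x \<in> S" "\<And>y. y \<in> S \<Longrightarrow> det (G y) \<noteq> 0"
    using continuous_at_open
      [THEN iffD1, OF differentiable_imp_continuous_within [OF detG], rule_format, of "- {0}"]
    by auto
  have solution: "sharp g y (l y) = (\<Sum>k\<in>UNIV. (det (X k y) / det (G y)) *\<^sub>R e k)" if y: "y \<in> S \<inter> U" for y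
  proof -
    interpret y: hermitian_form "g y"
      using hermitian y by simp
    have V: "(\<Sum>k\<in>UNIV. c y $ k *\<^sub>R e k) = sharp g y (l y)"
      using frame_expansion [OF e] by (simp add: c_def)
    have "G y *v c y = b y"
    proof (subst vec_eq_iff, intro allI)
      fix i
      have "(G y *v c y) $ i = g y (\<Sum>k\<in>UNIV. c y $ k *\<^sub>R e k) (e i)"
        by (simp add: matrix_vector_mult_def G_def y.h_sum_left y.h_linear mult.commute)
      also have "\<dots> = b y $ i"
        unfolding V using y lin by (simp add: g_sharp b_def)
      finally show "(G y *v c y) $ i = b y $ i" .
    qed
    then have "c y = (\<chi> k. det (X k y) / det (G y))"
      using cramer S(3) y unfolding X_def by blast
    then show ?thesis
      unfolding V [symmetric] by simp
  qed
  have diff_solution: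
    "(\<lambda>y. \<Sum>k\<in>UNIV. (det (X k y) / det (G y)) *\<^sub>R e k) differentiable (at x)"
    using S x detX detG
    by (intro differentiable_sum ballI differentiable_scaleR differentiable_divide) auto
  have "open (S \<inter> U)" "x \<in> S \<inter> U"
    using S x open_U by auto
  then show ?thesis
    using solution diff_solution by (rule differentiable_cong_open)
qed

lemma differentiable_chern:
  assumes x: "x \<in> U"
  shows "(\<lambda>y. chern y u v) differentiable (at x)"
  unfolding chern_def
  by (rule differentiable_sharp [OF x linear_chern_form])
     (intro differentiable_mult differentiable_diff differentiable_dg' differentiable_const x | assumption)+

section \<open>Torsion, Lee form and codifferential\<close>

lemma some_orthonormal_frame_pointwise:
  "some_orthonormal_frame g x = some_orthonormal_frame (\<lambda>_. g x) 0"
  by (simp add: some_orthonormal_frame_def orthonormal_frame_def)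

lemma bilinear_torsion: "x \<in> U \<Longrightarrow> bilinear (torsion g x)"
  by (rule bilinearI) (simp_all add: torsion_eq chern_linear algebra_simps)

lemma lee_form_metric_trace: "lee_form g x v = metric_trace (g x) (\<lambda>u w. g x (torsion g x v u) w)"
  by (simp add: lee_form_def metric_trace_def Let_def some_orthonormal_frame_pointwise)

text \<open>The definition of the Lee form uses at each point a frame about whose dependence on the point
  nothing is known; this expression is the one that can be differentiated.\<close>
lemma lee_form_eq_Basis_sum:
  assumes x: "x \<in> U"
  shows "lee_form g x v = (\<Sum>b\<in>Basis. torsion g x v b \<bullet> b)"
  unfolding lee_form_metric_trace
  by (rule hermitian_form.metric_trace_endomorphism [OF hermitian [OF x]])
     (use bilinear_torsion [OF x] in \<open>simp add: bilinear_def\<close>)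

lemma linear_lee_form: "x \<in> U \<Longrightarrow> linear (lee_form g x)"
  by (rule linearI)
     (simp_all add: lee_form_eq_Basis_sum bilinear_ladd [OF bilinear_torsion]
       bilinear_lmul [OF bilinear_torsion] inner_add_left sum.distrib sum_distrib_left)

lemma differentiable_lee_form:
  assumes x: "x \<in> U"
  shows "(\<lambda>y. lee_form g y v) differentiable (at x)"
proof (rule differentiable_cong_open [OF open_U x])
  show "lee_form g y v = (\<Sum>b\<in>Basis. (chern y v b - chern y b v) \<bullet> b)" if "y \<in> U" for y
    using that by (simp add: lee_form_eq_Basis_sum torsion_eq)
  show "(\<lambda>y. \<Sum>b\<in>Basis. (chern y v b - chern y b v) \<bullet> b) differentiable (at x)"
    by (intro differentiable_sum ballI finite_Basis differentiable_inner differentiable_diff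
        differentiable_chern x differentiable_const)
qed

text \<open>The Christoffel term is \<open>\<beta>\<close> applied to the trace \<open>H\<close> of the Christoffel tensor, and \<open>H\<close> is dual to
  \<open>-\<theta>\<close>: both \<open>g(H,z)\<close> and \<open>\<theta>(z)\<close> are sums of first derivatives of \<open>g\<close>, which are compared after
  passing from the frame \<open>e\<close> to the frame \<open>Je\<close> in one of them.\<close>
lemma codiff_eq:
  assumes x: "x \<in> U" and \<beta>: "linear (\<beta> x)"
  shows "codiff g \<beta> x = - metric_trace (g x) (\<lambda>u v. frechet_derivative (\<lambda>y. \<beta> y v) (at x) u)
     - metric_trace (g x) (\<lambda>u v. \<beta> x u * lee_form g x v)"
proof -
  interpret hermitian_form "g x"
    using hermitian x .
  let ?N = "2 * CARD('n)"
  define e where "e = some_orthonormal_frame (\<lambda>_. g x) 0"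
  have tr: "metric_trace (g x) B = (\<Sum>\<alpha><?N. B (e \<alpha>) (e \<alpha>))" for B
    by (simp add: metric_trace_def Let_def e_def)
  define H where "H = (\<Sum>\<alpha><?N. christoffel g x (e \<alpha>) (e \<alpha>))"
  have H: "g x H z = - lee_form g x z" for z
  proof -
    have "bilinear (\<lambda>u v. dg x u v z)"
      by (rule bilinearI) (simp_all add: dg_linear x)
    from metric_trace_J [OF this]
    have J: "(\<Sum>\<alpha><?N. dg x (J (e \<alpha>)) (J (e \<alpha>)) z) = (\<Sum>\<alpha><?N. dg x (e \<alpha>) (e \<alpha>) z)"
      by (simp add: tr)
    have "g x (torsion g x z v) v =
        1/2 * (dg x z v v - dg x v v z) - 1/2 * dg x (J v) (J v) z" for v
      using dg_J_left [OF x, of "J v" z v] dg_sym [OF x, of v z v] dg_sym [OF x, of "J v" z "J v"] x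
      by (simp add: torsion_eq g_linear g_chern field_simps)
    then have "lee_form g x z = (\<Sum>\<alpha><?N. 1/2 * (dg x z (e \<alpha>) (e \<alpha>) - dg x (e \<alpha>) (e \<alpha>) z))
        - 1/2 * (\<Sum>\<alpha><?N. dg x (J (e \<alpha>)) (J (e \<alpha>)) z)"
      by (simp add: lee_form_metric_trace tr sum_subtractf sum_distrib_left)
    also have "\<dots> = - (\<Sum>\<alpha><?N. dg x (e \<alpha>) (e \<alpha>) z - 1/2 * dg x z (e \<alpha>) (e \<alpha>))"
      unfolding J by (simp add: sum_subtractf sum_distrib_left [symmetric] sum_negf field_simps
          flip: sum_divide_distrib)
    finally show ?thesis
      by (simp add: H_def h_sum_left g_christoffel x diff_divide_distrib)
  qed
  have "(\<Sum>\<alpha><?N. \<beta> x (christoffel g x (e \<alpha>) (e \<alpha>))) = \<beta> x H"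
    by (simp add: H_def linear_sum [OF \<beta>])
  also have "\<dots> = - metric_trace (g x) (\<lambda>u v. \<beta> x u * lee_form g x v)"
    using metric_trace_contract [OF \<beta>, of H] H
    by (simp add: sym [of _ H] tr sum_negf)
  finally have "(\<Sum>\<alpha><?N. \<beta> x (christoffel g x (e \<alpha>) (e \<alpha>))) =
      - metric_trace (g x) (\<lambda>u v. \<beta> x u * lee_form g x v)" .
  then show ?thesis
    by (simp add: codiff_def some_orthonormal_frame_pointwise e_def [symmetric] sum_subtractf tr)
qed

lemma torsion_norm_sq_eq:
  "torsion_norm_sq g x = metric_trace (g x) (\<lambda>u u'. metric_trace (g x)
     (\<lambda>v v'. g x (torsion g x u v) (torsion g x u' v')))"
  by (simp add: torsion_norm_sq_def metric_trace_def Let_def some_orthonormal_frame_pointwise)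

section \<open>The Chern scalar curvature as a trace\<close>

text \<open>The Chern curvature on coordinate-constant fields, whose Lie bracket vanishes.\<close>
definition curvature :: "complex^'n \<Rightarrow> complex^'n \<Rightarrow> complex^'n \<Rightarrow> complex^'n \<Rightarrow> complex^'n" where
  "curvature x u v z =
     frechet_derivative (\<lambda>y. chern y v z) (at x) u - frechet_derivative (\<lambda>y. chern y u z) (at x) v
     + chern x u (chern x v z) - chern x v (chern x u z)"

lemma chern_curvature_const:
  assumes x: "x \<in> U"
  shows "chern_curvature g (\<lambda>_. u) (\<lambda>_. v) (\<lambda>_. z) (\<lambda>_. w) x = g x (curvature x u v z) w"
proof -
  have const: "chern_connection g (\<lambda>_. v) (\<lambda>_. z) y = chern y v z" if "y \<in> U" for y v z
    using that by (simp add: chern_connection_const)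
  have "frechet_derivative (chern_connection g (\<lambda>_. v) (\<lambda>_. z)) (at x) =
      frechet_derivative (\<lambda>y. chern y v z) (at x)" for v z
    by (rule frechet_derivative_cong_open [OF open_U x]) (rule const)
  moreover have "lie_bracket (\<lambda>_. u) (\<lambda>_. v) = (\<lambda>_. 0)"
    by (simp add: lie_bracket_def fun_eq_iff)
  ultimately show ?thesis
    by (simp add: chern_curvature_def chern_connection_const [OF x] const curvature_def x chern_linear
        algebra_simps)
qed

lemma curvature_swap: "curvature x u v z = - curvature x v u z"
  by (simp add: curvature_def)

lemma curvature_linear:
  assumes x: "x \<in> U"
  shows "curvature x (u + u') v z = curvature x u v z + curvature x u' v z"
    "curvature x (r *\<^sub>R u) v z = r *\<^sub>R curvature x u v z"
    "curvature x u v (z + z') = curvature x u v z + curvature x u v z'"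
    "curvature x u v (r *\<^sub>R z) = r *\<^sub>R curvature x u v z"
    "curvature x u v (J z) = J (curvature x u v z)"
proof -
  let ?D = "\<lambda>v z. frechet_derivative (\<lambda>y. chern y v z) (at x)"
  have lin: "linear (?D v z)" for v z
    by (rule linear_frechet_derivative [OF differentiable_chern [OF x]])
  note lins = linear_add [OF lin] linear_scale [OF lin]
  have cong: "(\<And>y. y \<in> U \<Longrightarrow> chern y v z = f y) \<Longrightarrow> ?D v z = frechet_derivative f (at x)" for v z f
    by (rule frechet_derivative_cong_open [OF open_U x])
  have add1: "?D (v + v') z u = ?D v z u + ?D v' z u"
    and add2: "?D v (z + z') u = ?D v z u + ?D v z' u" for v v' z z' u
    unfolding frechet_derivative_plus [OF differentiable_chern [OF x] differentiable_chern [OF x], symmetric]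
    by (rule fun_cong [OF cong], simp add: chern_linear)+
  have scale1: "?D (r *\<^sub>R v) z u = r *\<^sub>R ?D v z u"
    and scale2: "?D v (r *\<^sub>R z) u = r *\<^sub>R ?D v z u" for r v z u
    unfolding frechet_derivative_linear_image
      [OF bounded_linear_scaleR_right differentiable_chern [OF x], symmetric]
    by (rule fun_cong [OF cong], simp add: chern_linear)+
  have J: "?D v (J z) u = J (?D v z u)" for v z u
    unfolding frechet_derivative_linear_image
      [OF linear_conv_bounded_linear [THEN iffD1, OF linear_J] differentiable_chern [OF x], symmetric]
    by (rule fun_cong [OF cong]) (simp add: chern_J_right)
  have def: "curvature x u v z = ?D v z u - ?D u z v + chern x u (chern x v z) - chern x v (chern x u z)"
    for u v z
    by (simp add: curvature_def)
  note linears = lins add1 add2 scale1 scale2 J chern_linear [OF x] chern_J_right [OF x] J_linear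
  show "curvature x (u + u') v z = curvature x u v z + curvature x u' v z"
    unfolding def linears by simp
  show "curvature x (r *\<^sub>R u) v z = r *\<^sub>R curvature x u v z"
    unfolding def linears scaleR_add_right scaleR_diff_right by simp
  show "curvature x u v (z + z') = curvature x u v z + curvature x u v z'"
    unfolding def linears by simp
  show "curvature x u v (r *\<^sub>R z) = r *\<^sub>R curvature x u v z"
    unfolding def linears scaleR_add_right scaleR_diff_right by simp
  show "curvature x u v (J z) = J (curvature x u v z)"
    unfolding def linears by simp
qed

lemma some_unitary_frame_pointwise:
  "some_unitary_frame g x = some_unitary_frame (\<lambda>_. g x) 0"
  by (simp add: some_unitary_frame_def unitary_frame_def)

lemma bilinear_curvature_right:
  "x \<in> U \<Longrightarrow> bilinear (\<lambda>z z'. g x (curvature x u v z) (J z'))"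
  by (rule bilinearI) (simp_all add: curvature_linear g_linear J_linear)

lemma bilinear_curvature_left:
  assumes x: "x \<in> U"
  shows "bilinear (\<lambda>u u'. metric_trace (g x) (\<lambda>z z'. g x (curvature x u (J u') z) (J z')))"
proof -
  have "curvature x u (v + v') z = curvature x u v z + curvature x u v' z"
    "curvature x u (r *\<^sub>R v) z = r *\<^sub>R curvature x u v z" for u v v' z r
    unfolding curvature_swap [of x u _ z] by (simp_all add: curvature_linear x)
  then show ?thesis
    by (intro bilinearI)
       (simp_all add: curvature_linear x g_linear J_linear metric_trace_add metric_trace_cmult)
qed

text \<open>The curvature is antisymmetric in its first two arguments and commutes with \<open>J\<close>, so each of the two
  sums over a unitary frame is half of the trace over an orthonormal one.\<close>
lemma chern_scal_eq:
  assumes x: "x \<in> U"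
  shows "chern_scal g x = - 1/2 * metric_trace (g x) (\<lambda>u u'. metric_trace (g x)
     (\<lambda>z z'. g x (curvature x u (J u') z) (J z')))"
proof -
  interpret hermitian_form "g x"
    using hermitian x .
  define e where "e = some_unitary_frame (\<lambda>_. g x) 0"
  have e: "unitary_frame (\<lambda>_. g x) 0 e"
    unfolding e_def by (rule unitary_some_unitary_frame)
  have inner: "(\<Sum>j\<in>UNIV. g x (curvature x u v (e j)) (J (e j))) =
      metric_trace (g x) (\<lambda>z z'. g x (curvature x u v z) (J z')) / 2" for u v
    by (rule unitary_sum_eq_half_metric_trace [OF e bilinear_curvature_right [OF x]])
       (simp add: curvature_linear x g_linear g_J_left)
  have outer: "(\<Sum>i\<in>UNIV. metric_trace (g x) (\<lambda>z z'. g x (curvature x (e i) (J (e i)) z) (J z'))) =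
      metric_trace (g x) (\<lambda>u u'. metric_trace (g x) (\<lambda>z z'. g x (curvature x u (J u') z) (J z'))) / 2"
  proof (rule unitary_sum_eq_half_metric_trace [OF e bilinear_curvature_left [OF x]])
    fix u
    have "curvature x (J u) (J (J u)) z = curvature x u (J u) z" for z
      using curvature_swap [of x "J u" "J (J u)"] curvature_linear(2) [OF x, of "-1" u]
      by simp
    then show "metric_trace (g x) (\<lambda>z z'. g x (curvature x (J u) (J (J u)) z) (J z')) =
        metric_trace (g x) (\<lambda>z z'. g x (curvature x u (J u) z) (J z'))"
      by simp
  qed
  have "chern_scal g x = - 2 * (\<Sum>i\<in>UNIV. \<Sum>j\<in>UNIV. g x (curvature x (e i) (J (e i)) (e j)) (J (e j)))"
    by (simp add: chern_scal_def some_unitary_frame_pointwise e_def [symmetric]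
        chern_curvature_const x)
  then show ?thesis
    unfolding inner sum_divide_distrib [symmetric] outer by simp
qed

end

section \<open>Conformal change in a holomorphic chart\<close>

lemma bilinear_frechet_derivative_form:
  fixes \<beta> :: "complex^'n::finite \<Rightarrow> complex^'n \<Rightarrow> real"
  assumes U: "open U" "x \<in> U" and lin: "\<And>y. y \<in> U \<Longrightarrow> linear (\<beta> y)"
    and diff: "\<And>v. (\<lambda>y. \<beta> y v) differentiable (at x)"
  shows "bilinear (\<lambda>u v. frechet_derivative (\<lambda>y. \<beta> y v) (at x) u)"
proof (rule bilinearI)
  fix u v w and r :: real
  have D: "linear (frechet_derivative (\<lambda>y. \<beta> y v) (at x))" for v
    by (rule linear_frechet_derivative [OF diff])
  show "frechet_derivative (\<lambda>y. \<beta> y w) (at x) (u + v) =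
      frechet_derivative (\<lambda>y. \<beta> y w) (at x) u + frechet_derivative (\<lambda>y. \<beta> y w) (at x) v"
    by (rule linear_add [OF D])
  show "frechet_derivative (\<lambda>y. \<beta> y w) (at x) (r *\<^sub>R u) =
      r *\<^sub>R frechet_derivative (\<lambda>y. \<beta> y w) (at x) u"
    by (rule linear_scale [OF D])
  show "frechet_derivative (\<lambda>y. \<beta> y (u + v)) (at x) w =
      frechet_derivative (\<lambda>y. \<beta> y u) (at x) w + frechet_derivative (\<lambda>y. \<beta> y v) (at x) w"
    unfolding frechet_derivative_plus [OF diff diff, symmetric]
    by (rule fun_cong [OF frechet_derivative_cong_open [OF U]]) (simp add: linear_add [OF lin])
  show "frechet_derivative (\<lambda>y. \<beta> y (r *\<^sub>R u)) (at x) w =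
      r *\<^sub>R frechet_derivative (\<lambda>y. \<beta> y u) (at x) w"
    unfolding frechet_derivative_linear_image [OF bounded_linear_scaleR_right diff, symmetric]
    by (rule fun_cong [OF frechet_derivative_cong_open [OF U]]) (simp add: linear_scale [OF lin])
qed

locale conformal_chart = hermitian_chart U g
  for U :: "(complex^'n::finite) set" and g :: "'n tensor2" +
  fixes F :: "complex^'n \<Rightarrow> real"
  assumes differentiable_F: "x \<in> U \<Longrightarrow> F differentiable (at x)"
    and differentiable_dF: "x \<in> U \<Longrightarrow> (\<lambda>y. frechet_derivative F (at y) v) differentiable (at x)"
begin

definition dF :: "complex^'n \<Rightarrow> complex^'n \<Rightarrow> real" where
  "dF x v = frechet_derivative F (at x) v"

definition ddF :: "complex^'n \<Rightarrow> complex^'n \<Rightarrow> complex^'n \<Rightarrow> real" where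
  "ddF x u v = frechet_derivative (\<lambda>y. dF y v) (at x) u"

lemma linear_dF: "x \<in> U \<Longrightarrow> linear (dF x)"
  unfolding dF_def using linear_frechet_derivative [OF differentiable_F] by simp

lemmas dF_linear = linear_add [OF linear_dF] linear_scale [OF linear_dF] linear_neg [OF linear_dF]

lemma differentiable_dF': "x \<in> U \<Longrightarrow> (\<lambda>y. dF y v) differentiable (at x)"
  unfolding dF_def by (rule differentiable_dF)

lemma bilinear_ddF: "x \<in> U \<Longrightarrow> bilinear (ddF x)"
  unfolding ddF_def
  by (rule bilinear_frechet_derivative_form [OF open_U]) (simp_all add: linear_dF differentiable_dF')

lemmas ddF_linear = bilinear_ladd [OF bilinear_ddF] bilinear_radd [OF bilinear_ddF]
  bilinear_lmul [OF bilinear_ddF] bilinear_rmul [OF bilinear_ddF]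
  bilinear_lneg [OF bilinear_ddF] bilinear_rneg [OF bilinear_ddF]

lemma frechet_derivative_exp_F:
  "x \<in> U \<Longrightarrow> frechet_derivative (\<lambda>y. exp (F y)) (at x) v = exp (F x) * dF x v"
  using frechet_derivative_exp_cmult [OF differentiable_F, of x 1 v] by (simp add: dF_def)

lemma differentiable_exp_cmult: "x \<in> U \<Longrightarrow> (\<lambda>y. exp (k * F y)) differentiable (at x)"
  using has_derivative_exp_cmult [OF differentiable_F] unfolding differentiable_def by blast

lemma differentiable_exp_F: "x \<in> U \<Longrightarrow> (\<lambda>y. exp (F y)) differentiable (at x)"
  using differentiable_exp_cmult [of x 1] by simp

lemma derivative_conformal:
  assumes x: "x \<in> U"
  shows "frechet_derivative (\<lambda>y. exp (F y) * g y v w) (at x) u =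
    exp (F x) * (dg x u v w + dF x u * g x v w)"
  by (simp add: frechet_derivative_mult differentiable_exp_F differentiable_g x
      frechet_derivative_exp_F dg_def algebra_simps)

sublocale conformal: hermitian_chart U "\<lambda>x u v. exp (F x) * g x u v"
proof (rule hermitian_chart.intro)
  fix x assume x: "x \<in> U"
  show "hermitian_form (\<lambda>u v. exp (F x) * g x u v)"
    by (rule hermitian_form.hermitian_form_scale [OF hermitian [OF x]]) simp
  show "(\<lambda>y. exp (F y) * g y u v) differentiable (at x)" for u v
    by (intro differentiable_mult differentiable_exp_F differentiable_g x)
  show "(\<lambda>y. frechet_derivative (\<lambda>z. exp (F z) * g z u v) (at y) w) differentiable (at x)" for u v w
  proof (rule differentiable_cong_open [OF open_U x derivative_conformal])
    show "(\<lambda>y. exp (F y) * (dg y w u v + dF y w * g y u v)) differentiable (at x)"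
      by (intro differentiable_mult differentiable_add differentiable_exp_F differentiable_g
          differentiable_dg' differentiable_dF' x)
  qed
qed (rule open_U)

abbreviation g' :: "'n tensor2" where
  "g' \<equiv> \<lambda>x u v. exp (F x) * g x u v"

lemma metric_trace_conformal:
  "x \<in> U \<Longrightarrow> bilinear B \<Longrightarrow> metric_trace (g' x) B = metric_trace (g x) B / exp (F x)"
  by (rule hermitian_form.metric_trace_scale [OF hermitian]) simp_all

text \<open>The derivative of \<open>e\<^sup>F g\<close> along \<open>u\<close> is \<open>e\<^sup>F (\<partial>\<^sub>u g + dF(u) g)\<close>, which is inserted into the two terms of
  \<open>g_chern\<close>.\<close>
lemma conformal_chern:
  assumes x: "x \<in> U"
  shows "conformal.chern x u v = chern x u v + (1/2) *\<^sub>R (dF x u *\<^sub>R v - dF x (J u) *\<^sub>R J v)"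
proof (rule g_eqI [OF x])
  fix z
  have "exp (F x) * g x (conformal.chern x u v) z =
      exp (F x) * (1/2 * (dg x u v z + dF x u * g x v z - dg x (J u) (J v) z - dF x (J u) * g x (J v) z))"
    unfolding conformal.g_chern [OF x] conformal.dg_def derivative_conformal [OF x]
    by (simp add: algebra_simps)
  then have "g x (conformal.chern x u v) z =
      1/2 * (dg x u v z + dF x u * g x v z - dg x (J u) (J v) z - dF x (J u) * g x (J v) z)"
    by (simp only: mult_cancel_left exp_not_eq_zero simp_thms)
  then show "g x (conformal.chern x u v) z =
      g x (chern x u v + (1/2) *\<^sub>R (dF x u *\<^sub>R v - dF x (J u) *\<^sub>R J v)) z"
    by (simp add: g_linear x g_chern field_simps)
qed

lemma conformal_torsion:
  assumes x: "x \<in> U"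
  shows "torsion g' x u v = torsion g x u v
    + (1/2) *\<^sub>R (dF x u *\<^sub>R v - dF x (J u) *\<^sub>R J v - dF x v *\<^sub>R u + dF x (J v) *\<^sub>R J u)"
  by (simp add: conformal.torsion_eq torsion_eq x conformal_chern algebra_simps)

text \<open>The trace of an endomorphism is the same for both metrics, so only the change of the torsion counts.
  Its four terms contribute \<open>2n\<close>, \<open>0\<close>, \<open>-1\<close> and \<open>-1\<close> halves of \<open>dF\<close>.\<close>
lemma conformal_lee_form:
  assumes x: "x \<in> U"
  shows "lee_form g' x v = lee_form g x v + (real CARD('n) - 1) * dF x v"
proof -
  interpret h: hermitian_form "g x"
    using hermitian x .
  have lin: "linear (torsion g' x v)"
    using conformal.bilinear_torsion [OF x] by (simp add: bilinear_def)
  have "lee_form g' x v = metric_trace (g x) (\<lambda>u w. g x (torsion g' x v u) w)"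
    unfolding conformal.lee_form_eq_Basis_sum [OF x] h.metric_trace_endomorphism [OF lin] ..
  also have "\<dots> = metric_trace (g x) (\<lambda>u w. g x (torsion g x v u) w
      + 1/2 * (dF x v * g x u w - dF x (J v) * g x (J u) w - dF x u * g x w v
               + dF x (J u) * g x w (J v)))"
    by (simp add: conformal_torsion x g_linear g_sym [OF x, of v] g_sym [OF x, of "J v"])
  also have "\<dots> = lee_form g x v + 1/2 * (dF x v * (2 * real CARD('n)) - dF x (J v) * 0
      - dF x v + dF x (J (J v)))"
  proof -
    have 1: "metric_trace (g x) (\<lambda>u w. g x (J u) w) = 0"
      by (simp add: metric_trace_def)
    have "linear (\<lambda>u. dF x (J u))"
      using linear_compose [OF linear_J linear_dF [OF x]] by (simp add: o_def)
    note 2 = h.metric_trace_contract [OF this] h.metric_trace_contract [OF linear_dF [OF x]]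
    show ?thesis
      by (simp only: metric_trace_add metric_trace_diff metric_trace_cmult 1 2 h.metric_trace_self
          lee_form_metric_trace)
  qed
  finally show ?thesis
    by (simp add: dF_linear x algebra_simps)
qed

text \<open>The inner product scales by \<open>e\<^sup>F\<close> and each of the two traces by \<open>e\<^sup>-\<^sup>F\<close>; the rest is
  \<open>torsion_norm_conformal\<close>.\<close>
lemma conformal_torsion_norm_sq:
  assumes x: "x \<in> U"
  shows "exp (F x) * torsion_norm_sq g' x = torsion_norm_sq g x
     + 4 * metric_trace (g x) (\<lambda>u v. dF x u * lee_form g x v)
     + 2 * (real CARD('n) - 1) * metric_trace (g x) (\<lambda>u v. dF x u * dF x v)"
proof -
  interpret h: hermitian_form "g x"
    using hermitian x .
  note T_linear = bilinear_ladd [OF conformal.bilinear_torsion [OF x]]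
    bilinear_radd [OF conformal.bilinear_torsion [OF x]]
    bilinear_lmul [OF conformal.bilinear_torsion [OF x]]
    bilinear_rmul [OF conformal.bilinear_torsion [OF x]]
  let ?B = "\<lambda>u u' v v'. g x (torsion g' x u v) (torsion g' x u' v')"
  have 1: "bilinear (\<lambda>v v'. exp (F x) * ?B u u' v v')" for u u'
    by (rule bilinearI) (simp_all add: T_linear g_linear x algebra_simps)
  have 2: "bilinear (\<lambda>u u'. metric_trace (g x) (\<lambda>v v'. ?B u u' v v'))"
    by (rule bilinearI) (simp_all add: T_linear g_linear x metric_trace_add metric_trace_cmult)
  have "torsion_norm_sq g' x = metric_trace (g' x) (\<lambda>u u'. metric_trace (g x) (\<lambda>v v'. ?B u u' v v'))"
    unfolding conformal.torsion_norm_sq_eq metric_trace_conformal [OF x 1] by (simp add: metric_trace_cmult)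
  then have "exp (F x) * torsion_norm_sq g' x =
      metric_trace (g x) (\<lambda>u u'. metric_trace (g x) (\<lambda>v v'. ?B u u' v v'))"
    unfolding metric_trace_conformal [OF x 2] by simp
  also have "\<dots> = metric_trace (g x) (\<lambda>u u'. metric_trace (g x)
        (\<lambda>v v'. g x (torsion g x u v) (torsion g x u' v')))
      + 4 * metric_trace (g x) (\<lambda>u v. dF x u * lee_form g x v)
      + 2 * (real CARD('n) - 1) * metric_trace (g x) (\<lambda>u v. dF x u * dF x v)"
    by (rule h.torsion_norm_conformal [OF bilinear_torsion [OF x] _ _ linear_dF [OF x]
          lee_form_metric_trace conformal_torsion [OF x]])
       (simp_all add: torsion_eq x chern_J_left chern_J_right J_linear)
  finally show ?thesis
    by (simp add: torsion_norm_sq_eq)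
qed

text \<open>By \<open>codiff_eq\<close> the codifferential depends on the metric only through traces and the Lee form.\<close>
lemma conformal_codiff:
  assumes x: "x \<in> U" and \<beta>: "\<And>y. y \<in> U \<Longrightarrow> linear (\<beta> y)"
    and diff: "\<And>v. (\<lambda>y. \<beta> y v) differentiable (at x)"
  shows "exp (F x) * codiff g' \<beta> x =
    codiff g \<beta> x - (real CARD('n) - 1) * metric_trace (g x) (\<lambda>u v. \<beta> x u * dF x v)"
proof -
  define m where "m = real CARD('n) - 1"
  have 1: "bilinear (\<lambda>u v. frechet_derivative (\<lambda>y. \<beta> y v) (at x) u)"
    by (rule bilinear_frechet_derivative_form [OF open_U x \<beta> diff])
  have 2: "bilinear (\<lambda>u v. \<beta> x u * lee_form g' x v)"
    using linear_add [OF \<beta> [OF x]] linear_scale [OF \<beta> [OF x]]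
      linear_add [OF conformal.linear_lee_form [OF x]] linear_scale [OF conformal.linear_lee_form [OF x]]
    by (intro bilinearI) (simp_all add: algebra_simps)
  have "metric_trace (g x) (\<lambda>u v. \<beta> x u * lee_form g' x v) =
      metric_trace (g x) (\<lambda>u v. \<beta> x u * lee_form g x v + m * (\<beta> x u * dF x v))"
    unfolding conformal_lee_form [OF x] m_def [symmetric] by (simp add: algebra_simps)
  then have 3: "metric_trace (g x) (\<lambda>u v. \<beta> x u * lee_form g' x v) =
      metric_trace (g x) (\<lambda>u v. \<beta> x u * lee_form g x v)
      + m * metric_trace (g x) (\<lambda>u v. \<beta> x u * dF x v)"
    by (simp add: metric_trace_add metric_trace_cmult)
  show ?thesis
    unfolding conformal.codiff_eq [of x \<beta>, OF x \<beta> [OF x]] codiff_eq [of x \<beta>, OF x \<beta> [OF x]]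
      metric_trace_conformal [OF x 1] metric_trace_conformal [OF x 2]
      m_def [symmetric] 3
    by (simp add: field_simps)
qed

lemma conformal_codiff_lee_form:
  assumes x: "x \<in> U"
  shows "exp (F x) * codiff g' (lee_form g') x = codiff g (lee_form g) x
     - (real CARD('n) - 1) * (metric_trace (g x) (ddF x)
         + 2 * metric_trace (g x) (\<lambda>u v. dF x u * lee_form g x v)
         + (real CARD('n) - 1) * metric_trace (g x) (\<lambda>u v. dF x u * dF x v))"
proof -
  define m where "m = real CARD('n) - 1"
  define H where "H = metric_trace (g x) (ddF x)"
  define P where "P = metric_trace (g x) (\<lambda>u v. dF x u * lee_form g x v)"
  define Q where "Q = metric_trace (g x) (\<lambda>u v. dF x u * dF x v)"
  note lee = conformal_lee_form [folded m_def]
  have D: "frechet_derivative (\<lambda>y. lee_form g' y v) (at x) u =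
      frechet_derivative (\<lambda>y. lee_form g y v) (at x) u + m * ddF x u v" for u v
  proof -
    have "frechet_derivative (\<lambda>y. lee_form g' y v) (at x) u =
        frechet_derivative (\<lambda>y. lee_form g y v + m * dF y v) (at x) u"
      by (rule fun_cong [OF frechet_derivative_cong_open [OF open_U x lee]])
    also have "\<dots> = frechet_derivative (\<lambda>y. lee_form g y v) (at x) u
        + frechet_derivative (\<lambda>y. m * dF y v) (at x) u"
      by (intro frechet_derivative_plus differentiable_lee_form x differentiable_mult
          differentiable_const differentiable_dF')
    also have "frechet_derivative (\<lambda>y. m * dF y v) (at x) u = m * ddF x u v"
      unfolding ddF_def
      by (rule frechet_derivative_linear_image [OF bounded_linear_mult_right differentiable_dF' [OF x]])
    finally show ?thesis .
  qed
  have swap: "metric_trace (g x) (\<lambda>u v. lee_form g x u * dF x v) = P"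
    by (simp add: P_def metric_trace_def mult.commute)
  have "metric_trace (g x) (\<lambda>u v. lee_form g' x u * lee_form g x v) =
      metric_trace (g x) (\<lambda>u v. lee_form g x u * lee_form g x v + m * (dF x u * lee_form g x v))"
    by (simp add: lee x algebra_simps)
  then have 1: "codiff g (lee_form g') x = codiff g (lee_form g) x - m * (H + P)"
    unfolding codiff_eq [of x "lee_form g'", OF x conformal.linear_lee_form [OF x]]
      codiff_eq [of x "lee_form g", OF x linear_lee_form [OF x]] D
    by (simp add: metric_trace_add metric_trace_cmult H_def P_def distrib_left)
  have "metric_trace (g x) (\<lambda>u v. lee_form g' x u * dF x v) =
      metric_trace (g x) (\<lambda>u v. lee_form g x u * dF x v + m * (dF x u * dF x v))"
    by (simp add: lee x algebra_simps)
  then have 2: "metric_trace (g x) (\<lambda>u v. lee_form g' x u * dF x v) = P + m * Q"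
    by (simp add: metric_trace_add metric_trace_cmult swap Q_def)
  have 3: "exp (F x) * codiff g' (lee_form g') x = codiff g (lee_form g') x
      - (real CARD('n) - 1) * metric_trace (g x) (\<lambda>u v. lee_form g' x u * dF x v)"
    by (rule conformal_codiff [OF x conformal.linear_lee_form conformal.differentiable_lee_form [OF x]])
  show ?thesis
    unfolding 3 m_def [symmetric] H_def [symmetric] P_def [symmetric] Q_def [symmetric] 1 2
    by (simp add: algebra_simps)
qed

text \<open>The connection changes by the 1-form \<open>1/2 (dF(u) - dF(Ju) J)\<close>, whose values are complex multiples of
  the identity and hence commute with each other and with the connection.  So the curvature
  changes by the exterior derivative of that form.\<close>
lemma conformal_curvature:
  assumes x: "x \<in> U"
  shows "conformal.curvature x u v z = curvature x u v z
     + (1/2 * (ddF x u v - ddF x v u)) *\<^sub>R z - (1/2 * (ddF x u (J v) - ddF x v (J u))) *\<^sub>R J z"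
proof -
  have D: "frechet_derivative (\<lambda>y. conformal.chern y v z) (at x) u =
      frechet_derivative (\<lambda>y. chern y v z) (at x) u
      + (1/2 * ddF x u v) *\<^sub>R z - (1/2 * ddF x u (J v)) *\<^sub>R J z" for u v
  proof -
    have diff: "(\<lambda>y. dF y v *\<^sub>R w) differentiable (at x)" for v w
      by (intro differentiable_scaleR differentiable_const differentiable_dF' x)
    have dd: "frechet_derivative (\<lambda>y. dF y v *\<^sub>R w) (at x) u = ddF x u v *\<^sub>R w" for v w
      unfolding ddF_def
      by (rule frechet_derivative_linear_image [OF bounded_linear_scaleR_left differentiable_dF' [OF x]])
    have "frechet_derivative (\<lambda>y. conformal.chern y v z) (at x) u =
        frechet_derivative (\<lambda>y. chern y v z + (dF y v *\<^sub>R ((1/2) *\<^sub>R z)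
          - dF y (J v) *\<^sub>R ((1/2) *\<^sub>R J z))) (at x) u"
      by (rule fun_cong [OF frechet_derivative_cong_open [OF open_U x]])
         (simp add: conformal_chern algebra_simps)
    also have "\<dots> = frechet_derivative (\<lambda>y. chern y v z) (at x) u
        + (ddF x u v *\<^sub>R ((1/2) *\<^sub>R z) - ddF x u (J v) *\<^sub>R ((1/2) *\<^sub>R J z))"
      by (simp only: frechet_derivative_plus [OF differentiable_chern [OF x] differentiable_diff [OF diff diff]]
          frechet_derivative_minus [OF diff diff] dd)
    finally show ?thesis
      by (simp add: algebra_simps)
  qed
  show ?thesis
    unfolding conformal.curvature_def curvature_def D
    by (simp add: conformal_chern x chern_linear chern_J_right J_linear algebra_simps)
qed

text \<open>The multiple of \<open>z\<close> in \<open>conformal_curvature\<close> is orthogonal to \<open>Jz\<close> and drops out.  The trace over \<open>z\<close>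
  turns the multiple of \<open>Jz\<close> into \<open>2n\<close> times its coefficient, which is half of the Hessian on \<open>u\<close>
  plus half of the Hessian on \<open>Ju\<close>; these have equal traces.\<close>
lemma conformal_chern_scal:
  assumes x: "x \<in> U"
  shows "exp (F x) * chern_scal g' x = chern_scal g x - real CARD('n) * metric_trace (g x) (ddF x)"
proof -
  interpret h: hermitian_form "g x"
    using hermitian x .
  let ?R = "\<lambda>u u' z z'. g x (curvature x u (J u') z) (J z')"
  let ?R' = "\<lambda>u u' z z'. g x (conformal.curvature x u (J u') z) (J z')"
  let ?n = "real CARD('n)"
  have inner: "metric_trace (g' x) (\<lambda>z z'. exp (F x) * ?R' u u' z z') =
      metric_trace (g x) (\<lambda>z z'. ?R u u' z z') + ?n * (ddF x u u' + ddF x (J u') (J u))" for u u'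
  proof -
    have "?R' u u' z z' = ?R u u' z z' + 1/2 * (ddF x u (J u') - ddF x (J u') u) * g x z (J z')
        + 1/2 * (ddF x u u' + ddF x (J u') (J u)) * g x z z'" for z z'
      by (simp add: conformal_curvature x g_linear g_J ddF_linear algebra_simps)
    moreover have "metric_trace (g x) (\<lambda>z z'. g x z (J z')) = 0"
      by (simp add: metric_trace_def)
    ultimately have "metric_trace (g x) (\<lambda>z z'. ?R' u u' z z') =
        metric_trace (g x) (\<lambda>z z'. ?R u u' z z') + 1/2 * (ddF x u (J u') - ddF x (J u') u) * 0
        + 1/2 * (ddF x u u' + ddF x (J u') (J u)) * (2 * ?n)"
      by (simp only: metric_trace_add metric_trace_cmult h.metric_trace_self)
    then show ?thesis
      unfolding metric_trace_conformal [OF x conformal.bilinear_curvature_right [OF x]]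
      by (simp add: metric_trace_cmult)
  qed
  have "chern_scal g' x = - 1/2 * (metric_trace (g x) (\<lambda>u u'. metric_trace (g' x)
      (\<lambda>z z'. exp (F x) * ?R' u u' z z')) / exp (F x))"
    unfolding conformal.chern_scal_eq [OF x]
      metric_trace_conformal [OF x conformal.bilinear_curvature_left [OF x]] ..
  then have "exp (F x) * chern_scal g' x = - 1/2 * metric_trace (g x) (\<lambda>u u'. metric_trace (g' x)
      (\<lambda>z z'. exp (F x) * ?R' u u' z z'))"
    by simp
  also have "\<dots> = - 1/2 * (metric_trace (g x) (\<lambda>u u'. metric_trace (g x) (\<lambda>z z'. ?R u u' z z'))
      + ?n * (metric_trace (g x) (ddF x) + metric_trace (g x) (\<lambda>u u'. ddF x (J u') (J u))))"
    unfolding inner metric_trace_add metric_trace_cmult ..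
  also have "metric_trace (g x) (\<lambda>u u'. ddF x (J u') (J u)) = metric_trace (g x) (ddF x)"
    using metric_trace_transpose [of "g x" "\<lambda>u u'. ddF x (J u) (J u')"]
      h.metric_trace_J [OF bilinear_ddF [OF x]] by simp
  finally show ?thesis
    unfolding chern_scal_eq [OF x] by (simp add: algebra_simps)
qed

lemma conformal_deformed_scal:
  assumes x: "x \<in> U" and n: "CARD('n) \<ge> 2"
  shows "exp (F x) * deformed_scal t g' x = deformed_scal t g x
     - t * (metric_trace (g x) (ddF x) + metric_trace (g x) (\<lambda>u v. dF x u * lee_form g x v)
            + (real CARD('n) - 1) / 2 * metric_trace (g x) (\<lambda>u v. dF x u * dF x v))"
proof -
  let ?n = "real CARD('n)"
  define H where "H = metric_trace (g x) (ddF x)"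
  define P where "P = metric_trace (g x) (\<lambda>u v. dF x u * lee_form g x v)"
  define Q where "Q = metric_trace (g x) (\<lambda>u v. dF x u * dF x v)"
  have n1: "?n - 1 \<noteq> 0"
    using n by auto
  have "exp (F x) * deformed_scal t g' x = exp (F x) * chern_scal g' x
      + (t - ?n) / (?n - 1) * (exp (F x) * codiff g' (lee_form g') x)
      + (t - 2 * ?n) / 4 * (exp (F x) * torsion_norm_sq g' x)"
    by (simp add: deformed_scal_def Let_def algebra_simps)
  also have "\<dots> = chern_scal g x - ?n * H
      + (t - ?n) / (?n - 1) * (codiff g (lee_form g) x - (?n - 1) * (H + 2 * P + (?n - 1) * Q))
      + (t - 2 * ?n) / 4 * (torsion_norm_sq g x + 4 * P + 2 * (?n - 1) * Q)"
    unfolding conformal_chern_scal [OF x] conformal_codiff_lee_form [OF x]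
      conformal_torsion_norm_sq [OF x] H_def P_def Q_def ..
  also have "\<dots> = deformed_scal t g x - t * (H + P + (?n - 1) / 2 * Q)"
    using n1 by (simp add: deformed_scal_def Let_def right_diff_distrib) (simp add: field_simps)
  finally show ?thesis
    by (simp add: H_def P_def Q_def)
qed

lemma hodge_laplacian_exp:
  assumes x: "x \<in> U"
  shows "hodge_laplacian g (\<lambda>y. exp (k * F y)) x = - k * exp (k * F x) *
     (metric_trace (g x) (ddF x) + metric_trace (g x) (\<lambda>u v. dF x u * lee_form g x v)
      + k * metric_trace (g x) (\<lambda>u v. dF x u * dF x v))"
proof -
  let ?E = "\<lambda>y. exp (k * F y)"
  let ?\<beta> = "\<lambda>y. frechet_derivative ?E (at y)"
  have \<beta>: "?\<beta> y v = k * ?E y * dF y v" if "y \<in> U" for y v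
    using frechet_derivative_exp_cmult [OF differentiable_F [OF that]] by (simp add: dF_def)
  have D: "frechet_derivative (\<lambda>y. ?\<beta> y v) (at x) u = (k * ?E x) * (ddF x u v + k * (dF x u * dF x v))"
    for u v
  proof -
    have "frechet_derivative (\<lambda>y. ?\<beta> y v) (at x) u =
        frechet_derivative (\<lambda>y. k * (?E y * dF y v)) (at x) u"
      by (rule fun_cong [OF frechet_derivative_cong_open [OF open_U x]]) (simp add: \<beta>)
    also have "\<dots> = k * (?E x * ddF x u v + ?\<beta> x u * dF x v)"
      using differentiable_exp_cmult [OF x, of k] differentiable_dF' [OF x, of v]
      by (simp add: frechet_derivative_linear_image [OF bounded_linear_mult_right]
          frechet_derivative_mult ddF_def)
    finally show ?thesis
      by (simp add: \<beta> x algebra_simps)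
  qed
  have "linear (?\<beta> x)"
    by (rule linear_frechet_derivative [OF differentiable_exp_cmult [OF x]])
  from codiff_eq [of x ?\<beta>, OF x this] show ?thesis
    unfolding hodge_laplacian_def D unfolding \<beta> [OF x]
    by (simp add: metric_trace_add metric_trace_cmult mult.assoc) (simp add: algebra_simps)
qed

text \<open>For \<open>k = (n - 1)/2\<close> the bracket of \<open>conformal_deformed_scal\<close> is the one of \<open>hodge_laplacian_exp\<close>.\<close>
lemma conformal_deformed_scal_eq_iff:
  assumes x: "x \<in> U" and n: "CARD('n) \<ge> 2"
  defines "k \<equiv> (real CARD('n) - 1) / 2"
  shows "deformed_scal t g' x = c \<longleftrightarrow>
     2 * t / (real CARD('n) - 1) * hodge_laplacian g (\<lambda>y. exp (k * F y)) x
       + deformed_scal t g x * exp (k * F x) = c * (exp (F x) * exp (k * F x))"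
proof -
  have k: "k \<noteq> 0" "2 * t / (real CARD('n) - 1) = t / k"
    using n by (auto simp: k_def)
  have "2 * t / (real CARD('n) - 1) * hodge_laplacian g (\<lambda>y. exp (k * F y)) x
       + deformed_scal t g x * exp (k * F x) = exp (F x) * deformed_scal t g' x * exp (k * F x)"
    unfolding conformal_deformed_scal [OF x n] hodge_laplacian_exp [OF x] k(2)
    using k(1) by (simp add: k_def [symmetric]) (simp add: field_simps)
  then show ?thesis
    by auto
qed

end

section \<open>Smoothness and passage to the manifold\<close>

lemma Ck_on_cong:
  assumes "open S" "\<And>x. x \<in> S \<Longrightarrow> f x = g x" "Ck_on k S f"
  shows "Ck_on k S g"
  using assms(2,3)
proof (induction k arbitrary: f g)
  case 0
  then show ?case
    using continuous_on_cong by fastforce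
next
  case (Suc k)
  have diff: "g differentiable (at x)" if "x \<in> S" for x
    using Suc.prems that by (intro differentiable_cong_open [OF assms(1) that, of g f]) auto
  have D: "frechet_derivative f (at x) = frechet_derivative g (at x)" if "x \<in> S" for x
    by (rule frechet_derivative_cong_open [OF assms(1) that Suc.prems(1)])
  have "Ck_on k S (\<lambda>x. frechet_derivative g (at x) v)" for v
  proof (rule Suc.IH)
    show "Ck_on k S (\<lambda>x. frechet_derivative f (at x) v)"
      using Suc.prems(2) by simp
  qed (simp add: D)
  with diff show ?case
    by simp
qed

lemma Ck_on_Suc_imp_Ck_on:
  "Ck_on (Suc k) S f \<Longrightarrow> Ck_on k S f"
proof (induction k arbitrary: f)
  case 0
  then show ?case
    by (simp add: differentiable_imp_continuous_on differentiable_at_imp_differentiable_on)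
next
  case (Suc k)
  then show ?case
    unfolding Ck_on.simps(2) [of k] Ck_on.simps(2) [of "Suc k"] by blast
qed

lemma Ck_on_add:
  assumes "open S" "Ck_on k S f" "Ck_on k S g"
  shows "Ck_on k S (\<lambda>x. f x + g x)"
  using assms(2,3)
proof (induction k arbitrary: f g)
  case 0
  then show ?case
    by (simp add: continuous_on_add)
next
  case (Suc k)
  have "Ck_on k S (\<lambda>x. frechet_derivative (\<lambda>x. f x + g x) (at x) v)" for v
  proof (rule Ck_on_cong [OF assms(1)])
    show "Ck_on k S (\<lambda>x. frechet_derivative f (at x) v + frechet_derivative g (at x) v)"
      using Suc.prems by (intro Suc.IH) simp_all
  qed (use Suc.prems in \<open>simp add: frechet_derivative_plus\<close>)
  then show ?case
    using Suc.prems by simp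
qed

lemma Ck_on_mult:
  fixes f g :: "'a::real_normed_vector \<Rightarrow> real"
  assumes "open S" "Ck_on k S f" "Ck_on k S g"
  shows "Ck_on k S (\<lambda>x. f x * g x)"
  using assms(2,3)
proof (induction k arbitrary: f g)
  case 0
  then show ?case
    by (simp add: continuous_on_mult)
next
  case (Suc k)
  have fg: "Ck_on k S f" "Ck_on k S g"
    using Suc.prems Ck_on_Suc_imp_Ck_on by blast+
  have "Ck_on k S (\<lambda>x. frechet_derivative (\<lambda>x. f x * g x) (at x) v)" for v
  proof (rule Ck_on_cong [OF assms(1)])
    show "Ck_on k S (\<lambda>x. f x * frechet_derivative g (at x) v + frechet_derivative f (at x) v * g x)"
      using Suc.prems fg by (intro Ck_on_add [OF assms(1)] Suc.IH) simp_all
  qed (use Suc.prems in \<open>simp add: frechet_derivative_mult\<close>)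
  then show ?case
    using Suc.prems by (simp add: differentiable_mult)
qed

lemma Ck_on_const: "Ck_on k S (\<lambda>_. c)"
  by (induction k arbitrary: c) simp_all

lemma Ck_on_exp_cmult:
  fixes F :: "'a::real_normed_vector \<Rightarrow> real"
  assumes "open S" "Ck_on k S F"
  shows "Ck_on k S (\<lambda>x. exp (c * F x))"
  using assms(2)
proof (induction k)
  case 0
  then show ?case
    by (auto intro!: continuous_intros)
next
  case (Suc k)
  have diff: "F differentiable (at x)" if "x \<in> S" for x
    using Suc.prems that by simp
  have "Ck_on k S (\<lambda>x. frechet_derivative (\<lambda>x. exp (c * F x)) (at x) v)" for v
  proof (rule Ck_on_cong [OF assms(1)])
    show "Ck_on k S (\<lambda>x. c * exp (c * F x) * frechet_derivative F (at x) v)"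
      using Suc Ck_on_Suc_imp_Ck_on by (intro Ck_on_mult [OF assms(1)] Ck_on_const) auto
  qed (simp add: frechet_derivative_exp_cmult diff)
  moreover have "(\<lambda>x. exp (c * F x)) differentiable (at x)" if "x \<in> S" for x
    using has_derivative_exp_cmult [OF diff [OF that]] unfolding differentiable_def by blast
  ultimately show ?case
    by simp
qed

lemma smooth_on_exp_cmult:
  fixes F :: "'a::real_normed_vector \<Rightarrow> real"
  shows "open S \<Longrightarrow> smooth_on S F \<Longrightarrow> smooth_on S (\<lambda>x. exp (c * F x))"
  by (simp add: smooth_on_def Ck_on_exp_cmult)

lemma smooth_on_imp_differentiable:
  assumes "smooth_on S f" "x \<in> S"
  shows "f differentiable (at x)"
proof -
  have "Ck_on (Suc 0) S f"
    using assms(1) unfolding smooth_on_def by blast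
  then show ?thesis
    using assms(2) by simp
qed

lemma smooth_on_imp_differentiable_derivative:
  assumes "smooth_on S f" "x \<in> S"
  shows "(\<lambda>y. frechet_derivative f (at y) v) differentiable (at x)"
proof -
  have "Ck_on (Suc (Suc 0)) S f"
    using assms(1) unfolding smooth_on_def by blast
  then show ?thesis
    using assms(2) by simp
qed

lemma hermitian_metric_imp_hermitian_chart:
  assumes "complex_manifold M A" "hermitian_metric A g" "K \<in> A"
  shows "hermitian_chart (chart_image K) (g K)"
proof (rule hermitian_chart.intro)
  show "open (chart_image K)"
    using assms by (simp add: complex_manifold_def)
next
  fix x assume "x \<in> chart_image K"
  then have "bilinear (g K x) \<and> (\<forall>u v. g K x u v = g K x v u) \<and>
      (\<forall>u. u \<noteq> 0 \<longrightarrow> g K x u u > 0) \<and> (\<forall>u v. g K x (J u) (J v) = g K x u v)"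
    using assms(2,3) unfolding hermitian_metric_def by blast
  then show "hermitian_form (g K x)"
    by (auto intro: hermitian_form.intro)
next
  fix x u v w assume x: "x \<in> chart_image K"
  have "smooth_on (chart_image K) (\<lambda>x. g K x u v)"
    using assms(2,3) by (simp add: hermitian_metric_def)
  then show "(\<lambda>y. g K y u v) differentiable (at x)"
    and "(\<lambda>y. frechet_derivative (\<lambda>z. g K z u v) (at y) w) differentiable (at x)"
    using x by (rule smooth_on_imp_differentiable smooth_on_imp_differentiable_derivative)+
qed

lemma chart_inv_chart:
  assumes "complex_manifold M A" "K \<in> A" "p \<in> fst K"
  shows "snd K p \<in> chart_image K" "chart_inv K (snd K p) = p"
proof -
  have "openin M (fst K)"
      "homeomorphic_map (subtopology M (fst K)) (top_of_set (chart_image K)) (snd K)"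
    using assms by (simp_all add: complex_manifold_def)
  then have "inj_on (snd K) (fst K)"
    by (metis homeomorphic_imp_injective_map openin_subset topspace_subtopology_subset)
  then show "snd K p \<in> chart_image K" "chart_inv K (snd K p) = p"
    using assms(3) by (simp_all add: chart_image_def chart_inv_def)
qed

theorem proposition3p2:
  fixes M :: "'a topology"
    and A :: "('a, 'n::finite) chart set"
    and g :: "('a, 'n) chart \<Rightarrow> 'n tensor2"
    and f u :: "'a \<Rightarrow> real"
    and t c n :: real
  assumes "n = real CARD('n)" and "CARD('n) \<ge> 2"
    and "complex_manifold M A" and "compact_space M"
    and "hermitian_metric A g"
    and "smooth_function A f"
    and "u = (\<lambda>p. exp ((n - 1) / 2 * f p))"
  shows "(\<forall>K\<in>A. \<forall>p\<in>fst K. \<mu> t (conformal f g) K p = c) \<longleftrightarrow>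
         smooth_function A u \<and> (\<forall>p\<in>topspace M. u p > 0) \<and>
         (\<forall>K\<in>A. \<forall>p\<in>fst K.
            2 * t / (n - 1) * laplacian g u K p + \<mu> t g K p * u p
              = c * u p powr ((n + 1) / (n - 1)))"
proof -
  have smooth_u: "smooth_function A u"
    unfolding smooth_function_def
  proof
    fix K assume K: "K \<in> A"
    then have "open (chart_image K)" "smooth_on (chart_image K) (f \<circ> chart_inv K)"
      using assms(3,6) by (auto simp: complex_manifold_def smooth_function_def)
    then show "smooth_on (chart_image K) (u \<circ> chart_inv K)"
      using smooth_on_exp_cmult [of "chart_image K" "f \<circ> chart_inv K" "(n - 1) / 2"]
      by (simp add: assms(7) o_def)
  qed
  have "\<mu> t (conformal f g) K p = c \<longleftrightarrow>
      2 * t / (n - 1) * laplacian g u K p + \<mu> t g K p * u p = c * u p powr ((n + 1) / (n - 1))"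
    if K: "K \<in> A" and p: "p \<in> fst K" for K p
  proof -
    define x where "x = snd K p"
    have x: "x \<in> chart_image K" and inv: "chart_inv K x = p"
      unfolding x_def by (rule chart_inv_chart [OF assms(3) K p])+
    define F where "F = f \<circ> chart_inv K"
    have "smooth_on (chart_image K) F"
      using assms(6) K by (simp add: smooth_function_def F_def)
    then interpret conformal_chart "chart_image K" "g K" F
      using hermitian_metric_imp_hermitian_chart [OF assms(3,5) K]
      by (intro conformal_chart.intro conformal_chart_axioms.intro
          smooth_on_imp_differentiable smooth_on_imp_differentiable_derivative)
    have conf: "conformal f g K = g'"
      by (simp add: conformal_def F_def fun_eq_iff)
    have u_chart: "u \<circ> chart_inv K = (\<lambda>y. exp ((n - 1) / 2 * F y))"
      by (simp add: assms(7) F_def fun_eq_iff)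
    have u_p: "u p = exp ((n - 1) / 2 * F x)"
      by (simp add: assms(7) F_def inv)
    have "u p powr ((n + 1) / (n - 1)) = exp ((n - 1) / 2 * F x * ((n + 1) / (n - 1)))"
      unfolding u_p powr_def by (simp only: exp_not_eq_zero if_False ln_exp mult.commute)
    also have "(n - 1) / 2 * F x * ((n + 1) / (n - 1)) = F x + (n - 1) / 2 * F x"
    proof -
      define m where "m = n - 1"
      have "n = m + 1" "m \<noteq> 0"
        using assms(1,2) by (auto simp: m_def)
      then show ?thesis
        by (simp add: field_simps)
    qed
    finally have powr: "u p powr ((n + 1) / (n - 1)) = exp (F x) * exp ((n - 1) / 2 * F x)"
      by (simp add: exp_add)
    show ?thesis
      unfolding \<mu>_def laplacian_def conf u_chart powr x_def [symmetric]
      unfolding u_p unfolding assms(1) by (rule conformal_deformed_scal_eq_iff [OF x assms(2)])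
  qed
  then show ?thesis
    using smooth_u by (simp add: assms(7))
qed

end
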